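(* There exist absolute constants $C, \varepsilon > 0$ such that for every finite set $A\subset \mathbb{R}$, $$|A+\sqrt{2}\,A|\geq (1+\sqrt{2})^2|A| - C|A|^{1-\varepsilon}.$$
   Context: For a finite set $A\subset\mathbb{R}$ and a real number $\lambda$, $A+\lambda A:=\{a+\lambda b : a,b\in A\}$, and $|\cdot|$ denotes the cardinality of a finite set. *)

theory Defs
  imports Complex_Main
begin

definition sum_dilate :: "real \<Rightarrow> real set \<Rightarrow> real set" where
  "sum_dilate l A = {a + l * b | a b. a \<in> A \<and> b \<in> A}"

end

theory Submission
  imports Defs "HOL-Library.Set_Algebras" "HOL-Library.Product_Plus" "HOL-Library.FuncSet"
    "HOL-Number_Theory.Cong" "HOL-Computational_Algebra.Primes"
begin

text \<open>
  A generic \<open>\<rat>\<close>-linear functional moves \<open>A\<close> into \<open>\<int>\<^sup>2\<close>, where multiplication by \<open>sqrt 2\<close> becomes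
  \<open>T (x, y) = (2 y, x)\<close>. We may assume \<open>|A + T A| \<le> 6 |A|\<close>. By the Pluennecke--Ruzsa inequality,
  Ruzsa's modelling lemma and Bogolyubov's argument, \<open>2A - 2A\<close> then contains a progression
  \<open>0, v, 2v, \<dots>\<close> of length \<open>|A|\<^sup>\<epsilon>\<close>; multiplying \<open>A\<close> by the conjugate of \<open>v\<close> we may take \<open>v\<close> horizontal,
  and it follows that \<open>A\<close> meets only \<open>O(|A| powr (1 - \<epsilon>))\<close> rows and columns.
  After dividing by \<open>T\<close> as often as possible, \<open>A\<close> splits into two nonempty classes \<open>A\<^sub>0\<close>, \<open>A\<^sub>1\<close>
  according to the parity of the first coordinate, and \<open>A\<^sub>0 + T A\<close>, \<open>A\<^sub>1 + T A\<close> are disjoint.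
  If \<open>A\<^sub>0\<close> is the smaller class, with \<open>|A\<^sub>0| = s\<^sup>2 |A|\<close>, a discrete Brunn--Minkowski inequality bounds
  \<open>|A\<^sub>0 + T A|\<close> below by \<open>(1 + s)\<^sup>2 |A|\<close> up to the number of rows and columns, and induction is applied
  to \<open>A\<^sub>1\<close>. This suffices because \<open>1 + 2 s - (2 + 2 sqrt 2) s\<^sup>2 \<ge> 0\<close> for \<open>2 s\<^sup>2 \<le> 1\<close>.
\<close>

section \<open>Sumset inequalities\<close>

lemma finite_sumset [simp]: "finite A \<Longrightarrow> finite B \<Longrightarrow> finite (A + B)"
  by (rule finite_set_plus)

lemma card_translate [simp]:
  fixes A :: "'a::ab_group_add set"
  shows "card (A + {c}) = card A"
  by (rule card_plus_sing)

text \<open>Each difference \<open>d\<close> in \<open>U - W\<close> gets one chosen representation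
  \<open>u - w\<close>, and \<open>(x, d)\<close> is sent to \<open>(x + u, x + w)\<close>.
  Subtracting the coordinates recovers \<open>d\<close>, hence \<open>u\<close> and
  \<open>w\<close>, hence \<open>x\<close>.\<close>

lemma ruzsa_triangle:
  fixes X U W :: "'a::ab_group_add set"
  assumes "finite X" "finite U" "finite W"
  shows "card X * card (U + uminus ` W) \<le> card (X + U) * card (X + W)"
proof -
  have "\<exists>p. fst p \<in> U \<and> snd p \<in> W \<and> d = fst p - snd p" if "d \<in> U + uminus ` W" for d
    using that by (force elim!: set_plus_elim)
  then obtain p where p: "fst (p d) \<in> U" "snd (p d) \<in> W" "d = fst (p d) - snd (p d)"
    if "d \<in> U + uminus ` W" for d
    by metis
  let ?g = "\<lambda>(x, d). (x + fst (p d), x + snd (p d))"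
  have "inj_on ?g (X \<times> (U + uminus ` W))"
  proof (rule inj_onI, clarify)
    fix x d y e
    assume d: "d \<in> U + uminus ` W" and e: "e \<in> U + uminus ` W"
      and 1: "x + fst (p d) = y + fst (p e)" and 2: "x + snd (p d) = y + snd (p e)"
    have "fst (p d) - snd (p d) = fst (p e) - snd (p e)"
      using 1 2 by (metis add_diff_cancel_left)
    then have "d = e" using p(3) d e by metis
    then show "x = y \<and> d = e" using 1 by simp
  qed
  moreover have "?g ` (X \<times> (U + uminus ` W)) \<subseteq> (X + U) \<times> (X + W)"
    using p by auto
  ultimately have "card (X \<times> (U + uminus ` W)) \<le> card ((X + U) \<times> (X + W))"
    using assms by (intro card_inj_on_le) auto
  then show ?thesis by (simp add: card_cartesian_product)
qed

text \<open>By \<open>min\<close>, no nonempty subset of \<open>X\<close> has a smaller ratio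
  \<open>|Z + B| / |Z|\<close> than \<open>X\<close> itself. Elements are added to \<open>C\<close>
  one at a time, and the growth of \<open>X + B + C\<close> is compared with that of
  \<open>X + C\<close>.\<close>

lemma petridis:
  fixes X B C :: "'a::ab_group_add set"
  assumes fin: "finite X" "finite B" "finite C"
    and min: "\<And>Z. Z \<subseteq> X \<Longrightarrow> card (X + B) * card Z \<le> card (Z + B) * card X"
  shows "card X * card (X + B + C) \<le> card (X + B) * card (X + C)"
  using \<open>finite C\<close>
proof (induction C)
  case empty
  then show ?case by simp
next
  case (insert c C)
  \<comment> \<open>These points of \<open>X\<close> yield nothing new when \<open>c\<close> is
    added to \<open>C\<close>, neither in \<open>X + C\<close> nor, together with \<open>B\<close>,
    in \<open>X + B + C\<close>.\<close>
  define Z where "Z = {x \<in> X. x + c \<in> X + C}"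
  have ZX: "Z \<subseteq> X" by (auto simp: Z_def)
  have finZ: "finite Z" using ZX fin finite_subset by blast
  have split: "Y + insert c C = (Y + C) \<union> (Y + {c})" for Y :: "'a set"
    by (metis insert_is_Un set_plus_Un sup_commute)
  have "Z + B + {c} \<subseteq> X + B + C"
  proof
    fix y assume "y \<in> Z + B + {c}"
    then obtain z b where "z \<in> Z" "b \<in> B" and y: "y = z + b + c" by (auto elim!: set_plus_elim)
    from \<open>z \<in> Z\<close> have "z + c \<in> X + C" by (simp add: Z_def)
    then obtain x d where zc: "z + c = x + d" and "x \<in> X" "d \<in> C" by (rule set_plus_elim)
    have "y = (z + c) + b" by (simp add: y ac_simps)
    also have "\<dots> = x + b + d" unfolding zc by (simp add: ac_simps)
    finally have "y = x + b + d" .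
    then show "y \<in> X + B + C" using \<open>x \<in> X\<close> \<open>d \<in> C\<close> \<open>b \<in> B\<close> by auto
  qed
  then have "(X + B) + insert c C \<subseteq> (X + B + C) \<union> ((X + B + {c}) - (Z + B + {c}))"
    unfolding split by blast
  then have "card (X + B + insert c C) \<le> card ((X + B + C) \<union> ((X + B + {c}) - (Z + B + {c})))"
    using fin insert.hyps by (intro card_mono) auto
  also have "\<dots> \<le> card (X + B + C) + card ((X + B + {c}) - (Z + B + {c}))"
    by (rule card_Un_le)
  also have "card ((X + B + {c}) - (Z + B + {c})) = card (X + B + {c}) - card (Z + B + {c})"
    using fin finZ ZX by (intro card_Diff_subset) (simp_all add: set_plus_mono2)
  finally have 1: "card (X + B + insert c C) + card (Z + B) \<le> card (X + B + C) + card (X + B)"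
    using card_mono[of "X + B" "Z + B"] fin ZX by (auto simp: set_plus_mono2)
  have "X + insert c C = (X + C) \<union> ((X - Z) + {c})"
    unfolding split by (auto simp: Z_def set_plus_def)
  moreover have "(X + C) \<inter> ((X - Z) + {c}) = {}"
    by (auto simp: Z_def set_plus_def) metis
  ultimately have "card (X + insert c C) = card (X + C) + card ((X - Z) + {c})"
    using fin insert.hyps by (simp add: card_Un_disjoint)
  also have "\<dots> = card (X + C) + (card X - card Z)"
    using ZX finZ by (simp add: card_Diff_subset)
  finally have 2: "card (X + insert c C) + card Z = card (X + C) + card X"
    using card_mono[OF fin(1) ZX] by simp
  have "card X * card (X + B + insert c C) + card X * card (Z + B)
      \<le> card X * card (X + B + C) + card X * card (X + B)"
    using mult_left_mono[OF 1, of "card X"] by (simp add: distrib_left)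
  also have "\<dots> \<le> card (X + B) * card (X + C) + card (X + B) * card X"
    using insert.IH by (simp add: mult.commute)
  also have "\<dots> = card (X + B) * card (X + insert c C) + card (X + B) * card Z"
    using 2 by (metis distrib_left)
  also have "\<dots> \<le> card (X + B) * card (X + insert c C) + card X * card (Z + B)"
    using min[OF ZX] by (simp add: mult.commute)
  finally show ?case by simp
qed

primrec iterated_sumset :: "nat \<Rightarrow> 'a::comm_monoid_add set \<Rightarrow> 'a set" where
  "iterated_sumset 0 A = {0}"
| "iterated_sumset (Suc k) A = A + iterated_sumset k A"

lemma finite_iterated_sumset [simp]: "finite A \<Longrightarrow> finite (iterated_sumset k A)"
  by (induction k) auto

text \<open>For a nonempty \<open>X\<close> in \<open>A\<close> of least ratio
  \<open>|X + B| / |X|\<close>, \<open>petridis\<close> makes every further summand \<open>B\<close>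
  cost at most that ratio, which is at most \<open>K\<close>. The triangle inequality then passes
  from sums to differences.\<close>

lemma pluennecke_ruzsa:
  fixes A B :: "'a::ab_group_add set"
  assumes "finite A" "finite B" "A \<noteq> {}" and K: "real (card (A + B)) \<le> K * real (card A)"
  shows "real (card (iterated_sumset j B + uminus ` iterated_sumset k B))
    \<le> K ^ (j + k) * real (card A)"
proof -
  define r where "r X = real (card (X + B)) / real (card X)" for X
  have "finite (Pow A - {{}})" "Pow A - {{}} \<noteq> {}" using assms by auto
  then obtain X where X: "X \<in> Pow A - {{}}" and min: "\<And>Y. Y \<in> Pow A - {{}} \<Longrightarrow> r X \<le> r Y"
    using ex_is_arg_min_if_finite[of "Pow A - {{}}" r] unfolding is_arg_min_def by (metis not_le)
  have fX: "finite X" and X0: "card X > 0" and XA: "card X \<le> card A"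
    using X assms by (auto simp: finite_subset card_gt_0_iff intro: card_mono)
  have A0: "card A > 0" using assms by (simp add: card_gt_0_iff)
  have "r A \<le> K" using K A0 by (simp add: r_def field_simps)
  then have rK: "r X \<le> K" using min[of A] assms by force
  have r0: "r X \<ge> 0" by (simp add: r_def)
  have min': "card (X + B) * card Z \<le> card (Z + B) * card X" if "Z \<subseteq> X" for Z
  proof (cases "Z = {}")
    case False
    then have "card Z > 0" using that fX by (simp add: card_gt_0_iff finite_subset)
    have "r X \<le> r Z" using min[of Z] that X False by auto
    then have "real (card (X + B)) * real (card Z) \<le> real (card (Z + B)) * real (card X)"
      using X0 \<open>card Z > 0\<close> by (simp add: r_def field_simps)
    then show ?thesis by (metis of_nat_le_iff of_nat_mult)
  qed simp
  have grow: "real (card (X + iterated_sumset k B)) \<le> r X ^ k * real (card X)" for k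
  proof (induction k)
    case (Suc k)
    have "card X * card (X + B + iterated_sumset k B) \<le> card (X + B) * card (X + iterated_sumset k B)"
      by (rule petridis) (use fX assms min' in auto)
    then have "real (card X) * real (card (X + iterated_sumset (Suc k) B))
       \<le> real (card (X + B)) * real (card (X + iterated_sumset k B))"
      by (simp add: add.assoc) (metis of_nat_le_iff of_nat_mult)
    then have "real (card (X + iterated_sumset (Suc k) B)) \<le> r X * real (card (X + iterated_sumset k B))"
      using X0 by (simp add: r_def field_simps)
    also have "\<dots> \<le> r X * (r X ^ k * real (card X))"
      using Suc r0 by (intro mult_left_mono)
    finally show ?case by simp
  qed simp
  have "real (card X) * real (card (iterated_sumset j B + uminus ` iterated_sumset k B))
      \<le> real (card (X + iterated_sumset j B)) * real (card (X + iterated_sumset k B))"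
    using ruzsa_triangle[of X "iterated_sumset j B" "iterated_sumset k B"] fX assms
    by (metis finite_iterated_sumset of_nat_le_iff of_nat_mult)
  also have "\<dots> \<le> (r X ^ j * real (card X)) * (r X ^ k * real (card X))"
    using grow r0 by (intro mult_mono) auto
  finally have "real (card (iterated_sumset j B + uminus ` iterated_sumset k B))
      \<le> r X ^ (j + k) * real (card X)"
    using X0 by (simp add: power_add field_simps)
  also have "\<dots> \<le> K ^ (j + k) * real (card A)"
    using r0 rK XA by (intro mult_mono power_mono) auto
  finally show ?thesis .
qed

section \<open>Discrete Brunn-Minkowski inequality\<close>

text \<open>The translates \<open>Min A + B\<close> and \<open>A + Max B\<close> lie in
  \<open>A + B\<close> and share at most the point \<open>Min A + Max B\<close>.\<close>

lemma card_sumset_linorder_ge: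
  fixes A B :: "'a::linordered_ab_group_add set"
  assumes "finite A" "finite B" "A \<noteq> {}" "B \<noteq> {}"
  shows "card A + card B \<le> card (A + B) + 1"
proof -
  have "(+) (Min A) ` B \<inter> (\<lambda>x. x + Max B) ` A \<subseteq> {Min A + Max B}"
  proof clarify
    fix b a assume ab: "b \<in> B" "a \<in> A" and e: "Min A + b = a + Max B"
    have "Min A \<le> a" "b \<le> Max B" using ab assms by auto
    then have "a = Min A" using e by (metis add_less_le_mono order.strict_iff_order order_less_irrefl)
    then show "Min A + b = Min A + Max B" using e by simp
  qed
  then have "card ((+) (Min A) ` B \<inter> (\<lambda>x. x + Max B) ` A) \<le> 1"
    using card_mono[of "{Min A + Max B}"] by fastforce
  moreover have "Min A \<in> A" "Max B \<in> B" using assms by auto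
  then have "(+) (Min A) ` B \<union> (\<lambda>x. x + Max B) ` A \<subseteq> A + B"
    by (intro Un_least image_subsetI set_plus_intro)
  then have "card ((+) (Min A) ` B \<union> (\<lambda>x. x + Max B) ` A) \<le> card (A + B)"
    using assms by (intro card_mono) auto
  moreover have "card ((+) (Min A) ` B) = card B" "card ((\<lambda>x. x + Max B) ` A) = card A"
    by (auto intro!: card_image inj_onI)
  ultimately show ?thesis
    using card_Un_Int[of "(+) (Min A) ` B" "(\<lambda>x. x + Max B) ` A"] assms by simp
qed

text \<open>Delete the last column of either \<open>A\<close> or \<open>B\<close>; the average of the two resulting inductive bounds
  with weights \<open>m - 1\<close> and \<open>n - 1\<close> reproduces the bound exactly.\<close>

lemma card_sumset_columns_ge:
  fixes A B :: "('a::linordered_ab_group_add \<times> 'b::linordered_ab_group_add) set"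
  assumes "finite A" "finite B" "A \<noteq> {}" "B \<noteq> {}"
  shows "(real (card A) / real (card (fst ` A)) + real (card B) / real (card (fst ` B)) - 1) *
      (real (card (fst ` A)) + real (card (fst ` B)) - 1) \<le> real (card (A + B))"
  using assms
proof (induction "card (fst ` A) + card (fst ` B)" arbitrary: A B rule: less_induct)
  case less
  define m n where "m = card (fst ` A)" and "n = card (fst ` B)"
  define p q where "p = Max (fst ` A)" and "q = Max (fst ` B)"
  define A1 B1 where "A1 = {x \<in> A. fst x = p}" and "B1 = {x \<in> B. fst x = q}"
  have pA: "p \<in> fst ` A" and qB: "q \<in> fst ` B"
    unfolding p_def q_def using less.prems by (auto intro!: Max_in)
  have ple: "fst x \<le> p" if "x \<in> A" for x using that less.prems by (simp add: p_def)
  have qle: "fst x \<le> q" if "x \<in> B" for x using that less.prems by (simp add: q_def)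
  have fin1: "finite A1" "finite B1" "A1 \<noteq> {}" "B1 \<noteq> {}" "A1 \<subseteq> A" "B1 \<subseteq> B"
    using less.prems pA qB by (auto simp: A1_def B1_def)
  have top: "card A1 + card B1 \<le> card (A1 + B1) + 1"
  proof -
    have "card (snd ` A1) = card A1" "card (snd ` B1) = card B1" "snd ` A1 + snd ` B1 = snd ` (A1 + B1)"
      by (auto intro!: card_image inj_onI simp: A1_def B1_def prod_eq_iff set_plus_def image_iff, force+)
    then have "card A1 + card B1 \<le> card (snd ` (A1 + B1)) + 1"
      using card_sumset_linorder_ge[of "snd ` A1" "snd ` B1"] fin1 by simp
    also have "card (snd ` (A1 + B1)) \<le> card (A1 + B1)" using fin1 by (intro card_image_le) auto
    finally show ?thesis by simp
  qed
  have fA: "fst ` (A - A1) = fst ` A - {p}" and fB: "fst ` (B - B1) = fst ` B - {q}"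
    by (auto simp: A1_def B1_def)
  have cA: "card (fst ` (A - A1)) = m - 1" and cB: "card (fst ` (B - B1)) = n - 1"
    unfolding fA fB using pA qB less.prems by (simp_all add: m_def n_def)
  have m1: "m \<ge> 1" and n1: "n \<ge> 1"
    using less.prems by (simp_all add: m_def n_def Suc_le_eq card_gt_0_iff)
  have a: "real (card (A - A1)) = real (card A) - real (card A1)"
    using fin1 less.prems card_mono[of A A1] by (simp add: card_Diff_subset of_nat_diff)
  have b: "real (card (B - B1)) = real (card B) - real (card B1)"
    using fin1 less.prems card_mono[of B B1] by (simp add: card_Diff_subset of_nat_diff)
  \<comment> \<open>As \<open>p\<close> and \<open>q\<close> are the last columns, the first
    coordinate \<open>p + q\<close> arises only from \<open>A1 + B1\<close>. Deleting either last
    column therefore loses at least \<open>card (A1 + B1)\<close> sums.\<close>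
  have "fst x \<noteq> p + q" if "x \<in> (A - A1) + B" for x
    using that ple qle unfolding A1_def
    by (auto elim!: set_plus_elim) (metis add_le_less_mono add_less_le_mono fst_conv order_less_irrefl order_le_less)
  then have d1: "((A - A1) + B) \<inter> (A1 + B1) = {}"
    by (fastforce simp: A1_def B1_def elim!: set_plus_elim)
  have "fst x \<noteq> p + q" if "x \<in> A + (B - B1)" for x
    using that ple qle unfolding B1_def
    by (auto elim!: set_plus_elim) (metis add_le_less_mono add_less_le_mono fst_conv order_less_irrefl order_le_less)
  then have d2: "(A + (B - B1)) \<inter> (A1 + B1) = {}"
    by (fastforce simp: A1_def B1_def elim!: set_plus_elim)
  have sub: "(A - A1) + B \<subseteq> A + B" "A + (B - B1) \<subseteq> A + B" "A1 + B1 \<subseteq> A + B"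
    using fin1 by (simp_all add: set_plus_mono2)
  have s1: "card ((A - A1) + B) + card (A1 + B1) \<le> card (A + B)"
    using card_mono[of "A + B" "((A - A1) + B) \<union> (A1 + B1)"] sub d1 fin1 less.prems
    by (simp add: card_Un_disjoint)
  have s2: "card (A + (B - B1)) + card (A1 + B1) \<le> card (A + B)"
    using card_mono[of "A + B" "(A + (B - B1)) \<union> (A1 + B1)"] sub d2 fin1 less.prems
    by (simp add: card_Un_disjoint)
  let ?a = "real (card A)" and ?b = "real (card B)" and ?a1 = "real (card A1)" and ?b1 = "real (card B1)"
  let ?m = "real m" and ?n = "real n" and ?s = "real (card (A + B))"
  have alg: "u * (x / u + y / w - 1) = x + u * y / w - u" if "u \<noteq> 0" for u w x y :: real
    using that by (simp add: algebra_simps)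
  have swap: "w * F \<le> R" if "u * (E * w) \<le> R" "u * E = F" for u w E F R :: real
    using that(1) unfolding that(2)[symmetric] by (simp add: mult_ac)
  \<comment> \<open>The factor \<open>m - 1\<close> is the weight in the average; it also makes the
    estimate trivial for \<open>m = 1\<close>, where \<open>A - A1\<close> is empty and has no
    column average.\<close>
  have h1: "(?m - 1) * (?s - (?a1 + ?b1 - 1))
     \<ge> (?m + ?n - 2) * ((?a - ?a1) + (?m - 1) * ?b / ?n - (?m - 1))"
  proof (cases "m = 1")
    case True
    then have "A - A1 = {}" using cA less.prems by simp
    then have "A1 = A" using fin1 by blast
    then show ?thesis using True by simp
  next
    case False
    then have ne: "A - A1 \<noteq> {}" using cA m1 by force
    have "(real (card (A - A1)) / real (card (fst ` (A - A1))) + ?b / real (card (fst ` B)) - 1) *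
      (real (card (fst ` (A - A1))) + real (card (fst ` B)) - 1) \<le> real (card ((A - A1) + B))"
      by (rule less.hyps) (use ne less.prems cA m1 in \<open>auto simp: m_def\<close>)
    then have "((?a - ?a1) / (?m - 1) + ?b / ?n - 1) * (?m + ?n - 2) \<le> real (card ((A - A1) + B))"
      using m1 by (simp add: cA a n_def[symmetric] of_nat_diff algebra_simps)
    also have "\<dots> \<le> ?s - (?a1 + ?b1 - 1)" using s1 top by linarith
    finally have "(?m - 1) * (((?a - ?a1) / (?m - 1) + ?b / ?n - 1) * (?m + ?n - 2))
      \<le> (?m - 1) * (?s - (?a1 + ?b1 - 1))" using m1 by (intro mult_left_mono) auto
    moreover have "(?m - 1) * ((?a - ?a1) / (?m - 1) + ?b / ?n - 1)
        = (?a - ?a1) + (?m - 1) * ?b / ?n - (?m - 1)"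
      by (rule alg) (use False m1 in simp)
    ultimately show ?thesis by (rule swap)
  qed
  have h2: "(?n - 1) * (?s - (?a1 + ?b1 - 1))
     \<ge> (?m + ?n - 2) * ((?b - ?b1) + (?n - 1) * ?a / ?m - (?n - 1))"
  proof (cases "n = 1")
    case True
    then have "B - B1 = {}" using cB less.prems by simp
    then have "B1 = B" using fin1 by blast
    then show ?thesis using True by simp
  next
    case False
    then have ne: "B - B1 \<noteq> {}" using cB n1 by force
    have "(?a / real (card (fst ` A)) + real (card (B - B1)) / real (card (fst ` (B - B1))) - 1) *
      (real (card (fst ` A)) + real (card (fst ` (B - B1))) - 1) \<le> real (card (A + (B - B1)))"
      by (rule less.hyps) (use ne less.prems cB n1 in \<open>auto simp: n_def\<close>)
    then have "((?b - ?b1) / (?n - 1) + ?a / ?m - 1) * (?m + ?n - 2) \<le> real (card (A + (B - B1)))"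
      using n1 by (simp add: cB b m_def[symmetric] of_nat_diff algebra_simps)
    also have "\<dots> \<le> ?s - (?a1 + ?b1 - 1)" using s2 top by linarith
    finally have "(?n - 1) * (((?b - ?b1) / (?n - 1) + ?a / ?m - 1) * (?m + ?n - 2))
      \<le> (?n - 1) * (?s - (?a1 + ?b1 - 1))" using n1 by (intro mult_left_mono) auto
    moreover have "(?n - 1) * ((?b - ?b1) / (?n - 1) + ?a / ?m - 1)
        = (?b - ?b1) + (?n - 1) * ?a / ?m - (?n - 1)"
      by (rule alg) (use False n1 in simp)
    ultimately show ?thesis by (rule swap)
  qed
  have "(?a / ?m + ?b / ?n - 1) * (?m + ?n - 1) \<le> ?s"
  proof (cases "m = 1 \<and> n = 1")
    case True
    then have "A - A1 = {}" "B - B1 = {}" using cA cB less.prems by auto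
    then have "A1 = A" "B1 = B" using fin1 by auto
    then show ?thesis using True top by simp
  next
    case False
    then have pos: "?m + ?n - 2 > 0" using m1 n1 by linarith
    have "(?m + ?n - 2) * (?s - (?a1 + ?b1 - 1)) \<ge> (?m + ?n - 2) *
      ((?a - ?a1) + (?m - 1) * ?b / ?n - (?m - 1) + ((?b - ?b1) + (?n - 1) * ?a / ?m - (?n - 1)))"
      using add_mono[OF h1 h2] by (simp add: algebra_simps)
    then have "?s - (?a1 + ?b1 - 1) \<ge>
      (?a - ?a1) + (?m - 1) * ?b / ?n - (?m - 1) + ((?b - ?b1) + (?n - 1) * ?a / ?m - (?n - 1))"
      using pos by (simp only: mult_le_cancel_left_pos)
    moreover have "(?a / ?m + ?b / ?n - 1) * (?m + ?n - 1)
        = ?a + (?m - 1) * ?b / ?n + ?b + (?n - 1) * ?a / ?m - (?m + ?n - 1)"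
      using m1 n1 by (simp add: field_simps)
    ultimately show ?thesis by linarith
  qed
  then show ?case unfolding m_def n_def .
qed

section \<open>Progressions in difference sets\<close>

text \<open>Orthogonality of characters: the sum is geometric, and its ratio \<open>z\<close> is an
  \<open>N\<close>-th root of unity that equals 1 exactly when \<open>N\<close> divides
  \<open>n\<close>.\<close>

lemma sum_cis_mod:
  fixes n :: int
  assumes "N > 0"
  shows "(\<Sum>\<xi><N. cis (2 * pi * real_of_int (n * int \<xi>) / real N))
    = (if int N dvd n then of_nat N else 0)"
proof -
  define z where "z = cis (2 * pi * real_of_int n / real N)"
  have pow: "cis (2 * pi * real_of_int (n * int \<xi>) / real N) = z ^ \<xi>" for \<xi>
    by (simp add: z_def DeMoivre mult_ac)
  have zN: "z ^ N = 1"
  proof -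
    have "z ^ N = cis (2 * pi * real_of_int n)" using assms by (simp add: z_def DeMoivre)
    then show ?thesis by (metis Ints_of_int cis_multiple_2pi)
  qed
  show ?thesis
  proof (cases "int N dvd n")
    case True
    then obtain k where "n = int N * k" by blast
    then have "2 * pi * real_of_int n / real N = 2 * pi * real_of_int k" using assms by simp
    then have "z = cis (2 * pi * real_of_int k)" by (simp only: z_def)
    then have "z = 1" by (metis Ints_of_int cis_multiple_2pi)
    then show ?thesis unfolding pow using True by simp
  next
    case False
    have "z \<noteq> 1"
    proof
      assume "z = 1"
      then have "cos (2 * pi * real_of_int n / real N) = 1" by (metis z_def cis.sel(1) one_complex.sel(1))
      then obtain k :: int where "2 * pi * real_of_int n / real N = of_int k * (2 * pi)"
        by (auto simp: cos_one_2pi_int mult_ac)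
      then have "real_of_int n = real_of_int (int N * k)" using assms by (simp add: field_simps)
      then have "n = int N * k" by (simp only: of_int_eq_iff)
      then show False using False by simp
    qed
    then show ?thesis unfolding pow using False zN by (simp add: geometric_sum)
  qed
qed

text \<open>Expanding the squared modulus gives a sum over pairs, and orthogonality keeps those with
  \<open>\<sigma> p - \<sigma> q\<close> congruent to \<open>x\<close>. The cosine is the real part
  of the character at \<open>x\<close>; for \<open>x = 0\<close> and \<open>\<sigma>\<close>
  injective modulo \<open>N\<close> this is Parseval's identity.\<close>

lemma fourier_correlation:
  fixes \<sigma> :: "'a \<Rightarrow> int" and x :: int
  assumes "N > 0" "finite P"
  shows "(\<Sum>\<xi><N. (cmod (\<Sum>p\<in>P. cis (2 * pi * real_of_int (\<sigma> p * int \<xi>) / real N)))\<^sup>2 *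
      cos (2 * pi * real_of_int (x * int \<xi>) / real N))
    = real N * real (card {(p, q). p \<in> P \<and> q \<in> P \<and> int N dvd \<sigma> p - \<sigma> q - x})"
proof -
  define e where "e n = cis (2 * pi * real_of_int n / real N)" for n
  have e_add: "e (m + n) = e m * e n" for m n
    by (simp add: e_def cis_mult add_divide_distrib distrib_left)
  have e_cnj: "cnj (e n) = e (- n)" for n
    by (simp add: e_def cis_cnj)
  have exp: "of_real ((cmod (\<Sum>p\<in>P. e (\<sigma> p * int \<xi>)))\<^sup>2) * e (- (x * int \<xi>))
      = (\<Sum>(p, q)\<in>P \<times> P. e ((\<sigma> p - \<sigma> q - x) * int \<xi>))" for \<xi>
  proof -
    have "of_real ((cmod (\<Sum>p\<in>P. e (\<sigma> p * int \<xi>)))\<^sup>2)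
       = (\<Sum>p\<in>P. e (\<sigma> p * int \<xi>)) * (\<Sum>p\<in>P. e (- (\<sigma> p * int \<xi>)))"
      by (simp only: complex_norm_square cnj_sum e_cnj)
    also have "\<dots> = (\<Sum>(p, q)\<in>P \<times> P. e (\<sigma> p * int \<xi>) * e (- (\<sigma> q * int \<xi>)))"
      by (simp add: sum_product sum.cartesian_product)
    finally have eq: "of_real ((cmod (\<Sum>p\<in>P. e (\<sigma> p * int \<xi>)))\<^sup>2)
      = (\<Sum>(p, q)\<in>P \<times> P. e (\<sigma> p * int \<xi>) * e (- (\<sigma> q * int \<xi>)))" .
    show ?thesis
      unfolding eq sum_distrib_right
      by (intro sum.cong) (auto simp: e_add[symmetric] algebra_simps)
  qed
  have "(\<Sum>\<xi><N. of_real ((cmod (\<Sum>p\<in>P. e (\<sigma> p * int \<xi>)))\<^sup>2) * e (- (x * int \<xi>)))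
     = (\<Sum>(p, q)\<in>P \<times> P. \<Sum>\<xi><N. e ((\<sigma> p - \<sigma> q - x) * int \<xi>))"
    unfolding exp by (subst sum.swap) (simp add: case_prod_unfold)
  also have "\<dots> = (\<Sum>(p, q)\<in>P \<times> P. if int N dvd \<sigma> p - \<sigma> q - x then of_nat N else 0)"
    unfolding e_def sum_cis_mod[OF assms(1)] ..
  also have "\<dots> = (\<Sum>w\<in>{(p, q). p \<in> P \<and> q \<in> P \<and> int N dvd \<sigma> p - \<sigma> q - x}. of_nat N)"
    using assms(2) by (intro sum.mono_neutral_cong_right) (auto split: if_splits)
  finally have "Re (\<Sum>\<xi><N. of_real ((cmod (\<Sum>p\<in>P. e (\<sigma> p * int \<xi>)))\<^sup>2) * e (- (x * int \<xi>)))
     = Re (of_nat (card {(p, q). p \<in> P \<and> q \<in> P \<and> int N dvd \<sigma> p - \<sigma> q - x}) * of_nat N)"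
    by simp
  then show ?thesis by (simp add: e_def mult.commute)
qed

section \<open>Bogolyubov's argument\<close>

text \<open>\<open>\<Gamma>\<close> is the large spectrum of \<open>S\<close>. Up to a factor
  \<open>N\<close>, the number of representations of \<open>x\<close> as
  \<open>a + b - c - d\<close> is a sum of \<open>|F|^4\<close> times cosines: frequency 0 gives
  \<open>s^4\<close>, the rest of \<open>\<Gamma>\<close> a nonnegative amount, and the remaining
  frequencies at least \<open>- s^4 / 4\<close>.\<close>

lemma bogolyubov:
  fixes \<rho> :: "'a \<Rightarrow> int"
  assumes N: "N > 0" and S: "finite S" "S \<noteq> {}"
    and inj: "\<And>a b. a \<in> S \<Longrightarrow> b \<in> S \<Longrightarrow> int N dvd \<rho> a - \<rho> b \<Longrightarrow> a = b"
  obtains \<Gamma> where "\<Gamma> \<subseteq> {..<N}" "real (card \<Gamma>) \<le> 4 * (real N)\<^sup>2 / (real (card S))\<^sup>2"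
    "\<And>x :: int. (\<And>\<xi>. \<xi> \<in> \<Gamma> \<Longrightarrow> 0 \<le> cos (2 * pi * real_of_int (x * int \<xi>) / real N)) \<Longrightarrow>
      \<exists>a\<in>S. \<exists>b\<in>S. \<exists>c\<in>S. \<exists>d\<in>S. int N dvd \<rho> a + \<rho> b - \<rho> c - \<rho> d - x"
proof -
  define F where "F \<xi> = (\<Sum>a\<in>S. cis (2 * pi * real_of_int (\<rho> a * int \<xi>) / real N))" for \<xi>
  define s where "s = real (card S)"
  \<comment> \<open>By Parseval this threshold gives
    \<open>|\<Gamma>| \<le> N * s / \<tau> = 4 * N^2 / s^2\<close>, while the frequencies below it
    contribute at most \<open>\<tau> * N * s = s^4 / 4\<close> to the fourth moment.\<close>
  define \<tau> where "\<tau> = s ^ 3 / (4 * real N)"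
  define \<Gamma> where "\<Gamma> = {\<xi>. \<xi> < N \<and> \<tau> \<le> (cmod (F \<xi>))\<^sup>2}"
  have s0: "s > 0" using S by (simp add: s_def card_gt_0_iff)
  have fin\<Gamma>: "finite \<Gamma>" by (simp add: \<Gamma>_def)
  have "{(p, q). p \<in> S \<and> q \<in> S \<and> int N dvd \<rho> p - \<rho> q - 0} = (\<lambda>a. (a, a)) ` S"
    using inj by auto
  then have "card {(p, q). p \<in> S \<and> q \<in> S \<and> int N dvd \<rho> p - \<rho> q - 0} = card S"
    by (simp add: card_image inj_on_def)
  then have parseval: "(\<Sum>\<xi><N. (cmod (F \<xi>))\<^sup>2) = real N * s"
    using fourier_correlation[OF N S(1), of \<rho> 0] by (simp add: F_def s_def)
  have F0: "F 0 = of_real s" by (simp add: F_def s_def)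
  have sN: "s \<le> real N"
  proof -
    have "(cmod (F 0))\<^sup>2 \<le> (\<Sum>\<xi><N. (cmod (F \<xi>))\<^sup>2)"
      using N by (intro member_le_sum) auto
    then have "s * s \<le> real N * s" unfolding parseval F0 using s0 by (simp add: power2_eq_square)
    then show ?thesis using s0 by simp
  qed
  have "real (card \<Gamma>) * \<tau> \<le> (\<Sum>\<xi>\<in>\<Gamma>. (cmod (F \<xi>))\<^sup>2)"
    using sum_mono[of \<Gamma> "\<lambda>_. \<tau>" "\<lambda>\<xi>. (cmod (F \<xi>))\<^sup>2"] by (simp add: \<Gamma>_def)
  also have "\<dots> \<le> (\<Sum>\<xi><N. (cmod (F \<xi>))\<^sup>2)"
    by (intro sum_mono2) (auto simp: \<Gamma>_def)
  finally have "real (card \<Gamma>) * \<tau> \<le> real N * s" by (simp add: parseval)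
  then have "real (card \<Gamma>) * s ^ 3 \<le> 4 * (real N)\<^sup>2 * s"
    using N by (simp add: \<tau>_def field_simps power2_eq_square)
  then have "s * (real (card \<Gamma>) * s\<^sup>2) \<le> s * (4 * (real N)\<^sup>2)"
    by (simp add: power2_eq_square power3_eq_cube mult_ac)
  then have "real (card \<Gamma>) * s\<^sup>2 \<le> 4 * (real N)\<^sup>2"
    using s0 by simp
  then have card\<Gamma>: "real (card \<Gamma>) \<le> 4 * (real N)\<^sup>2 / s\<^sup>2"
    using s0 by (simp add: field_simps)
  have main: "\<exists>a\<in>S. \<exists>b\<in>S. \<exists>c\<in>S. \<exists>d\<in>S. int N dvd \<rho> a + \<rho> b - \<rho> c - \<rho> d - x"
    if x: "\<And>\<xi>. \<xi> \<in> \<Gamma> \<Longrightarrow> 0 \<le> cos (2 * pi * real_of_int (x * int \<xi>) / real N)" for x :: int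
  proof (rule ccontr)
    assume none: "\<not> ?thesis"
    define w where "w \<xi> = (cmod (F \<xi>)) ^ 4 * cos (2 * pi * real_of_int (x * int \<xi>) / real N)" for \<xi>
    let ?\<sigma> = "\<lambda>p. \<rho> (fst p) + \<rho> (snd p)"
    have "{(p, q). p \<in> S \<times> S \<and> q \<in> S \<times> S \<and> int N dvd ?\<sigma> p - ?\<sigma> q - x} = {}"
      using none by (auto simp: algebra_simps)
    then have "card {(p, q). p \<in> S \<times> S \<and> q \<in> S \<times> S \<and> int N dvd ?\<sigma> p - ?\<sigma> q - x} = 0"
      by (simp only: card.empty)
    moreover have "(\<Sum>p\<in>S \<times> S. cis (2 * pi * real_of_int (?\<sigma> p * int \<xi>) / real N)) = (F \<xi>)\<^sup>2" for \<xi>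
      by (simp add: F_def power2_eq_square sum_product sum.cartesian_product case_prod_unfold
          cis_mult algebra_simps add_divide_distrib)
    moreover have "(cmod ((F \<xi>)\<^sup>2))\<^sup>2 = (cmod (F \<xi>)) ^ 4" for \<xi>
      by (simp add: norm_power)
    ultimately have "(\<Sum>\<xi><N. w \<xi>) = 0"
      using fourier_correlation[OF N, of "S \<times> S" ?\<sigma> x] S
      by (simp only: w_def finite_cartesian_product of_nat_0 mult_zero_right)
    moreover have "(\<Sum>\<xi><N. w \<xi>) = (\<Sum>\<xi>\<in>\<Gamma>. w \<xi>) + (\<Sum>\<xi>\<in>{..<N} - \<Gamma>. w \<xi>)"
      by (subst add.commute, rule sum.subset_diff) (auto simp: \<Gamma>_def)
    moreover have "s ^ 4 \<le> (\<Sum>\<xi>\<in>\<Gamma>. w \<xi>)"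
    proof -
      have "s ^ 3 \<le> s\<^sup>2 * real N" using sN s0 by (simp add: power2_eq_square power3_eq_cube)
      also have "\<dots> \<le> s\<^sup>2 * (4 * real N)" by (intro mult_left_mono) auto
      finally have "0 \<in> \<Gamma>" using N s0 by (simp add: \<Gamma>_def \<tau>_def F0 field_simps)
      then have "w 0 \<le> (\<Sum>\<xi>\<in>\<Gamma>. w \<xi>)"
        using x fin\<Gamma> by (intro member_le_sum) (auto simp: w_def)
      then show ?thesis using s0 by (simp add: w_def F0)
    qed
    moreover have "- (s ^ 4 / 4) \<le> (\<Sum>\<xi>\<in>{..<N} - \<Gamma>. w \<xi>)"
    proof -
      have "- (\<tau> * (cmod (F \<xi>))\<^sup>2) \<le> w \<xi>" if "\<xi> \<in> {..<N} - \<Gamma>" for \<xi>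
      proof -
        have "(cmod (F \<xi>))\<^sup>2 \<le> \<tau>" using that by (auto simp: \<Gamma>_def)
        then have "(cmod (F \<xi>))\<^sup>2 * (cmod (F \<xi>))\<^sup>2 \<le> \<tau> * (cmod (F \<xi>))\<^sup>2"
          by (intro mult_right_mono) auto
        then have "(cmod (F \<xi>)) ^ 4 \<le> \<tau> * (cmod (F \<xi>))\<^sup>2"
          by (simp add: power2_eq_square power4_eq_xxxx mult_ac)
        moreover have "(cmod (F \<xi>)) ^ 4 * (-1) \<le> w \<xi>"
          unfolding w_def by (intro mult_left_mono) auto
        ultimately show ?thesis by linarith
      qed
      then have "(\<Sum>\<xi>\<in>{..<N} - \<Gamma>. - (\<tau> * (cmod (F \<xi>))\<^sup>2)) \<le> (\<Sum>\<xi>\<in>{..<N} - \<Gamma>. w \<xi>)"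
        by (rule sum_mono)
      moreover have "(\<Sum>\<xi>\<in>{..<N} - \<Gamma>. \<tau> * (cmod (F \<xi>))\<^sup>2) \<le> (\<Sum>\<xi><N. \<tau> * (cmod (F \<xi>))\<^sup>2)"
        using s0 by (intro sum_mono2) (auto simp: \<tau>_def)
      moreover have "(\<Sum>\<xi><N. \<tau> * (cmod (F \<xi>))\<^sup>2) = s ^ 4 / 4"
        unfolding sum_distrib_left[symmetric] parseval using N
        by (simp add: \<tau>_def power4_eq_xxxx power3_eq_cube)
      ultimately show ?thesis by (simp add: sum_negf)
    qed
    ultimately have "s ^ 4 - s ^ 4 / 4 \<le> 0" by linarith
    then show False using s0 by simp
  qed
  show ?thesis
    by (rule that[of \<Gamma>]) (use card\<Gamma> main in \<open>auto simp: \<Gamma>_def s_def\<close>)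
qed

text \<open>Pigeonhole: the \<open>N\<close> values of \<open>t\<close> fall into at most
  \<open>M ^ d\<close> boxes of side \<open>1 / M\<close>, so two of them share a box, and their
  difference lies strictly between 0 and \<open>N\<close>.\<close>

lemma dirichlet_simultaneous:
  assumes "\<Gamma> \<subseteq> {..<N}" "card \<Gamma> \<le> d" "M > 0" "M ^ d < N"
  obtains t :: int where "\<not> int N dvd t"
    "\<And>\<xi>. \<xi> \<in> \<Gamma> \<Longrightarrow> \<exists>z :: int. \<bar>real_of_int (t * int \<xi>) / real N - of_int z\<bar> < 1 / real M"
proof -
  define f where "f t = (\<lambda>\<xi>\<in>\<Gamma>. nat \<lfloor>real M * frac (real t * real \<xi> / real N)\<rfloor>)" for t :: nat
  have fin: "finite \<Gamma>" using assms(1) finite_subset by blast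
  have "f t \<in> \<Gamma> \<rightarrow>\<^sub>E {..<M}" for t
  proof -
    have "nat \<lfloor>real M * frac y\<rfloor> < M" for y
    proof -
      have "real M * frac y < real M * 1" using assms(3) frac_lt_1 by (intro mult_strict_left_mono) auto
      then have "\<lfloor>real M * frac y\<rfloor> < int M" by (simp add: floor_less_iff)
      then show ?thesis using assms(3) by (simp add: nat_less_iff)
    qed
    then show ?thesis by (auto simp: f_def)
  qed
  then have "f ` {..<N} \<subseteq> \<Gamma> \<rightarrow>\<^sub>E {..<M}" by auto
  then have "card (f ` {..<N}) \<le> M ^ card \<Gamma>"
    using card_mono[of "\<Gamma> \<rightarrow>\<^sub>E {..<M}"] fin by (simp add: finite_PiE card_PiE)
  also have "\<dots> \<le> M ^ d" using assms by (intro power_increasing) auto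
  finally have "card (f ` {..<N}) < card {..<N}" using assms(4) by simp
  then have "\<not> inj_on f {..<N}" by (rule pigeonhole)
  then obtain t1 t2 where t: "t1 < N" "t2 < N" "t1 < t2" "f t1 = f t2"
    unfolding inj_on_def by (metis lessThan_iff linorder_neqE_nat)
  show ?thesis
  proof (rule that[of "int t2 - int t1"])
    show "\<not> int N dvd int t2 - int t1"
      using t by (auto dest!: zdvd_imp_le)
    fix \<xi> assume "\<xi> \<in> \<Gamma>"
    define u v where "u = real t1 * real \<xi> / real N" and "v = real t2 * real \<xi> / real N"
    have "nat \<lfloor>real M * frac u\<rfloor> = nat \<lfloor>real M * frac v\<rfloor>"
      using fun_cong[OF t(4), of \<xi>] \<open>\<xi> \<in> \<Gamma>\<close> unfolding f_def u_def v_def by simp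
    moreover have "0 \<le> \<lfloor>real M * frac u\<rfloor>" "0 \<le> \<lfloor>real M * frac v\<rfloor>" by simp_all
    ultimately have "\<lfloor>real M * frac u\<rfloor> = \<lfloor>real M * frac v\<rfloor>" by (simp add: eq_nat_nat_iff)
    then have "\<bar>real M * frac v - real M * frac u\<bar> < 1" by linarith
    then have "real M * \<bar>frac v - frac u\<bar> < 1"
      by (simp add: abs_mult flip: right_diff_distrib)
    then have "\<bar>frac v - frac u\<bar> < 1 / real M" using assms(3) by (simp add: field_simps)
    moreover have "real_of_int ((int t2 - int t1) * int \<xi>) / real N = v - u"
      by (simp add: u_def v_def algebra_simps diff_divide_distrib)
    moreover have "v - u - of_int (\<lfloor>v\<rfloor> - \<lfloor>u\<rfloor>) = frac v - frac u" by (simp add: frac_def)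
    ultimately show "\<exists>z :: int. \<bar>real_of_int ((int t2 - int t1) * int \<xi>) / real N - of_int z\<bar> < 1 / real M"
      by metis
  qed
qed

lemma cos_nonneg_of_near_int:
  assumes "\<bar>y - of_int z\<bar> \<le> 1 / 4"
  shows "0 \<le> cos (2 * pi * y)"
proof -
  have "cos (2 * pi * y) = cos (2 * pi * (y - of_int z))"
    by (simp add: right_diff_distrib cos_diff)
  moreover have "0 \<le> cos (2 * pi * (y - of_int z))"
  proof (rule cos_ge_zero)
    have "\<bar>2 * pi * (y - of_int z)\<bar> \<le> 2 * pi * (1 / 4)"
      unfolding abs_mult using assms by (intro mult_mono) auto
    then show "- (pi / 2) \<le> 2 * pi * (y - of_int z)" "2 * pi * (y - of_int z) \<le> pi / 2" by linarith+
  qed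
  ultimately show ?thesis by simp
qed

text \<open>Density at least \<open>1 / c\<close> leaves at most \<open>4 * c\<^sup>2\<close>
  frequencies in the spectrum. For \<open>t\<close> from simultaneous approximation,
  \<open>k * t * \<xi> / N\<close> is within \<open>k / M \<le> 1 / 4\<close> of an integer, so the
  cosines in \<open>bogolyubov\<close> are nonnegative for all these \<open>k\<close>.\<close>

lemma bogolyubov_progression:
  fixes \<rho> :: "'a \<Rightarrow> int"
  assumes S: "finite S" "S \<noteq> {}"
    and inj: "\<And>a b. a \<in> S \<Longrightarrow> b \<in> S \<Longrightarrow> int N dvd \<rho> a - \<rho> b \<Longrightarrow> a = b"
    and N: "N \<le> c * card S" and M: "M > 0" "M ^ (4 * c\<^sup>2) < N"
  obtains t :: int where "\<not> int N dvd t"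
    "\<And>k. k \<le> M div 4 \<Longrightarrow>
      \<exists>a\<in>S. \<exists>b\<in>S. \<exists>c\<in>S. \<exists>d\<in>S. int N dvd \<rho> a + \<rho> b - \<rho> c - \<rho> d - int k * t"
proof -
  have N0: "N > 0" using M by simp
  obtain \<Gamma> where \<Gamma>: "\<Gamma> \<subseteq> {..<N}" "real (card \<Gamma>) \<le> 4 * (real N)\<^sup>2 / (real (card S))\<^sup>2"
    and bog: "\<And>x :: int. (\<And>\<xi>. \<xi> \<in> \<Gamma> \<Longrightarrow> 0 \<le> cos (2 * pi * real_of_int (x * int \<xi>) / real N)) \<Longrightarrow>
      \<exists>a\<in>S. \<exists>b\<in>S. \<exists>c\<in>S. \<exists>d\<in>S. int N dvd \<rho> a + \<rho> b - \<rho> c - \<rho> d - x"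
    using bogolyubov[OF N0 S, of \<rho>] inj by metis
  have s0: "card S > 0" using S by (simp add: card_gt_0_iff)
  have "(real N)\<^sup>2 \<le> (real (c * card S))\<^sup>2" using N by (intro power_mono) (auto simp del: of_nat_mult)
  then have "4 * (real N)\<^sup>2 / (real (card S))\<^sup>2 \<le> 4 * (real c)\<^sup>2"
    using s0 by (simp add: field_simps power_mult_distrib)
  then have "real (card \<Gamma>) \<le> real (4 * c\<^sup>2)" using \<Gamma>(2) by simp
  then have "card \<Gamma> \<le> 4 * c\<^sup>2" by (simp only: of_nat_le_iff)
  then obtain t :: int where t: "\<not> int N dvd t"
    "\<And>\<xi>. \<xi> \<in> \<Gamma> \<Longrightarrow> \<exists>z :: int. \<bar>real_of_int (t * int \<xi>) / real N - of_int z\<bar> < 1 / real M"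
    using dirichlet_simultaneous[OF \<Gamma>(1) _ M] by metis
  show ?thesis
  proof (rule that[OF t(1)], rule bog)
    fix k \<xi> assume k: "k \<le> M div 4" and "\<xi> \<in> \<Gamma>"
    then obtain z :: int where z: "\<bar>real_of_int (t * int \<xi>) / real N - of_int z\<bar> < 1 / real M"
      using t by blast
    have "real_of_int (int k * t * int \<xi>) / real N - of_int (int k * z)
      = real k * (real_of_int (t * int \<xi>) / real N - of_int z)"
      by (simp add: algebra_simps)
    then have "\<bar>real_of_int (int k * t * int \<xi>) / real N - of_int (int k * z)\<bar>
      = real k * \<bar>real_of_int (t * int \<xi>) / real N - of_int z\<bar>"
      by (simp add: abs_mult)
    also have "\<dots> \<le> (real M / 4) * (1 / real M)"
      using z k by (intro mult_mono) auto
    also have "\<dots> = 1 / 4" using M by simp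
    finally show "0 \<le> cos (2 * pi * real_of_int (int k * t * int \<xi>) / real N)"
      using cos_nonneg_of_near_int by (metis times_divide_eq_right)
  qed
qed

section \<open>Ruzsa's modelling lemma\<close>

lemma sumset_eq_empty_iff [simp]: "A + B = {} \<longleftrightarrow> A = {} \<or> B = {}"
  by (auto simp: set_plus_def)

lemma card_sumset_ge_left:
  fixes A B :: "'a::ab_group_add set"
  assumes "finite A" "finite B" "B \<noteq> {}"
  shows "card A \<le> card (A + B)"
proof -
  obtain b where "b \<in> B" using assms by blast
  then have "A + {b} \<subseteq> A + B" by (intro set_plus_mono2) auto
  then have "card (A + {b}) \<le> card (A + B)" using assms by (intro card_mono) auto
  then show ?thesis by simp
qed

lemma iterated_sumset_nonempty [simp]: "A \<noteq> {} \<Longrightarrow> iterated_sumset k A \<noteq> {}"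
  by (induction k) auto

lemma sum_list_in_iterated_sumset:
  "set l \<subseteq> A \<Longrightarrow> sum_list l \<in> iterated_sumset (length l) A"
  by (induction l) (auto intro!: set_plus_intro)

lemma mult_mod_inj:
  fixes x q r :: int
  assumes "prime p" "\<not> p dvd x" "q \<in> {1..p - 1}" "r \<in> {1..p - 1}" "q * x mod p = r * x mod p"
  shows "q = r"
proof -
  have "p dvd (q - r) * x"
    using assms(5) by (simp add: mod_eq_dvd_iff left_diff_distrib)
  then have "p dvd q - r" using assms(1,2) by (simp add: prime_dvd_mult_iff)
  then have "q mod p = r mod p" by (simp add: mod_eq_dvd_iff)
  then show ?thesis using assms(3,4) by simp
qed

lemma card_multiples_le:
  fixes m :: int
  assumes "N > 0" "m \<ge> 0"
  shows "card {y \<in> {1..m}. int N dvd y} * N \<le> nat m"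
proof -
  have "inj_on (\<lambda>y. y div int N) {y \<in> {1..m}. int N dvd y}"
    using assms by (auto intro!: inj_onI)
  moreover have "(\<lambda>y. y div int N) ` {y \<in> {1..m}. int N dvd y} \<subseteq> {1..m div int N}"
  proof clarsimp
    fix y assume y: "1 \<le> y" "y \<le> m" "int N dvd y"
    then have "int N \<le> y" by (simp add: zdvd_imp_le)
    then show "1 \<le> y div int N \<and> y div int N \<le> m div int N"
      using zdiv_mono1[of "int N" y "int N"] zdiv_mono1[OF y(2), of "int N"] assms(1) by simp
  qed
  ultimately have "card {y \<in> {1..m}. int N dvd y} \<le> card {1..m div int N}"
    by (intro card_inj_on_le) auto
  also have "\<dots> = nat m div N" using assms by (simp add: nat_div_distrib)
  finally have "card {y \<in> {1..m}. int N dvd y} * N \<le> (nat m div N) * N" by simp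
  then show ?thesis by (meson div_times_less_eq_dividend le_trans)
qed

text \<open>The map \<open>\<rho>\<close> is \<open>a \<mapsto> q * \<phi> a mod p\<close> with \<open>p\<close> a large prime, and \<open>S\<close> consists of those elements whose
  image lies in one of six intervals of length \<open>p / 6\<close>. By counting, some \<open>q\<close> sends no nonzero
  element of \<open>6A - 6A\<close> to a multiple of \<open>N\<close>.\<close>

lemma freiman_model:
  fixes A :: "'a::ab_group_add set" and \<phi> :: "'a \<Rightarrow> int"
  defines "D \<equiv> iterated_sumset 6 A + uminus ` iterated_sumset 6 A"
  assumes A: "finite A" "A \<noteq> {}" and N: "card D < N"
    and \<phi>: "\<And>x y. \<phi> (x + y) = \<phi> x + \<phi> y" and \<phi>D: "\<And>x. x \<in> D \<Longrightarrow> \<phi> x = 0 \<Longrightarrow> x = 0"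
  obtains S and \<rho> :: "'a \<Rightarrow> int" where "S \<subseteq> A" "card A \<le> 6 * card S"
    "\<And>l1 l2. set l1 \<subseteq> S \<Longrightarrow> set l2 \<subseteq> S \<Longrightarrow> length l1 = 6 \<Longrightarrow> length l2 = 6 \<Longrightarrow>
      int N dvd sum_list (map \<rho> l1) - sum_list (map \<rho> l2) \<longleftrightarrow> sum_list l1 = sum_list l2"
proof -
  interpret \<phi>: additive \<phi> by standard (rule \<phi>)
  have finD: "finite D" using A by (simp add: D_def)
  have D0: "D \<noteq> {}" using A by (simp add: D_def)
  have Dminus: "- x \<in> D" if "x \<in> D" for x
    using that unfolding D_def by (force simp: set_plus_def)
  have N0: "N > 0" using N by simp
  \<comment> \<open>The prime exceeds \<open>|\<phi> x|\<close> for every \<open>x\<close> in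
    \<open>D\<close>, so it divides none of these values unless \<open>x = 0\<close>.\<close>
  define P where "P = Max ((\<lambda>x. nat \<bar>\<phi> x\<bar>) ` D) + 1"
  obtain p' :: nat where p': "prime p'" "p' > P" using bigger_prime by blast
  define p where "p = int p'"
  have p: "prime p" using p' by (simp add: p_def)
  have p1: "p > 1" using prime_gt_1_int[OF p] .
  have ndvd: "\<not> p dvd \<phi> x" if "x \<in> D" "x \<noteq> 0" for x
  proof
    assume "p dvd \<phi> x"
    moreover have "\<phi> x \<noteq> 0" using \<phi>D that by blast
    ultimately have "p \<le> \<bar>\<phi> x\<bar>" using dvd_imp_le_int by (metis abs_of_pos p1 less_trans zero_less_one)
    moreover have "nat \<bar>\<phi> x\<bar> \<le> Max ((\<lambda>x. nat \<bar>\<phi> x\<bar>) ` D)" using that finD by simp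
    ultimately show False using p'(2) unfolding p_def P_def by linarith
  qed
  \<comment> \<open>The multipliers to avoid. Multiplication by \<open>\<phi> x\<close> is injective
    on nonzero residues, so each \<open>x\<close> spoils at most \<open>(p - 1) / N\<close> of them,
    and \<open>card D < N\<close> leaves a good one.\<close>
  define bad where "bad x = {q \<in> {1..p - 1}. int N dvd q * \<phi> x mod p}" for x
  have bad: "card (bad x) * N \<le> nat (p - 1)" if "x \<in> D - {0}" for x
  proof -
    have "inj_on (\<lambda>q. q * \<phi> x mod p) (bad x)"
      by (rule inj_onI, rule mult_mod_inj[OF p]) (use that ndvd in \<open>auto simp: bad_def\<close>)
    moreover have "q * \<phi> x mod p \<in> {y \<in> {1..p - 1}. int N dvd y}" if q: "q \<in> bad x" for q
    proof -
      have "\<not> p dvd q" using q zdvd_imp_le[of p q] by (auto simp: bad_def)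
      then have "\<not> p dvd q * \<phi> x" using ndvd \<open>x \<in> D - {0}\<close> p by (auto simp: prime_dvd_mult_iff)
      then have "q * \<phi> x mod p \<noteq> 0" by (simp add: dvd_eq_mod_eq_0)
      moreover have "0 \<le> q * \<phi> x mod p" "q * \<phi> x mod p < p" using p1 by simp_all
      ultimately have "1 \<le> q * \<phi> x mod p" "q * \<phi> x mod p \<le> p - 1" by linarith+
      then show ?thesis using q by (simp add: bad_def)
    qed
    moreover have "finite {y \<in> {1..p - 1}. int N dvd y}"
      by (rule finite_subset[of _ "{1..p - 1}"]) auto
    ultimately have "card (bad x) \<le> card {y \<in> {1..p - 1}. int N dvd y}"
      by (intro card_inj_on_le[of "\<lambda>q. q * \<phi> x mod p"]) blast+
    then have "card (bad x) * N \<le> card {y \<in> {1..p - 1}. int N dvd y} * N" by simp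
    also have "\<dots> \<le> nat (p - 1)" using N0 p1 by (intro card_multiples_le) auto
    finally show ?thesis .
  qed
  have "card (\<Union>x\<in>D - {0}. bad x) * N \<le> (\<Sum>x\<in>D - {0}. card (bad x)) * N"
    using finD by (intro mult_right_mono card_UN_le) auto
  also have "\<dots> = (\<Sum>x\<in>D - {0}. card (bad x) * N)" by (simp add: sum_distrib_right)
  also have "\<dots> \<le> (\<Sum>x\<in>D - {0}. nat (p - 1))" by (intro sum_mono bad)
  also have "\<dots> \<le> card D * nat (p - 1)" using finD by (simp add: card_Diff1_le)
  also have "\<dots> < nat (p - 1) * N" using N p1 by simp
  finally have "card (\<Union>x\<in>D - {0}. bad x) < card {1..p - 1}" by simp
  moreover have "(\<Union>x\<in>D - {0}. bad x) \<subseteq> {1..p - 1}" by (auto simp: bad_def)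
  ultimately have "(\<Union>x\<in>D - {0}. bad x) \<subset> {1..p - 1}" by (auto simp: psubset_eq)
  then obtain q where q1: "q \<in> {1..p - 1}" "q \<notin> (\<Union>x\<in>D - {0}. bad x)" by blast
  then have q: "\<not> int N dvd q * \<phi> x mod p" if "x \<in> D" "x \<noteq> 0" for x
    using that by (simp add: bad_def)
  define \<rho> where "\<rho> a = q * \<phi> a mod p" for a
  have \<rho>: "0 \<le> \<rho> a" "\<rho> a < p" for a using p1 by (simp_all add: \<rho>_def)
  define h where "h a = nat (6 * \<rho> a div p)" for a
  have "h a < 6" for a
  proof -
    have "6 * \<rho> a div p \<le> (6 * p - 1) div p" using \<rho>[of a] p1 by (intro zdiv_mono1) auto
    moreover have "(6 * p - 1) div p = 5" using p1 by (intro int_div_pos_eq[of _ _ _ "p - 1"]) auto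
    ultimately have "6 * \<rho> a div p < 6" by simp
    then show ?thesis by (simp add: h_def)
  qed
  then have "h \<in> A \<rightarrow> {..<6}" by auto
  moreover have "{..<6::nat} \<noteq> {}" by (simp add: lessThan_empty_iff)
  ultimately obtain i where i: "card A \<le> card (h -` {i} \<inter> A) * 6"
    using pigeonhole_card[of h A "{..<6}"] A(1) by force
  define S where "S = h -` {i} \<inter> A"
  have S: "S \<subseteq> A" "card A \<le> 6 * card S" using i by (auto simp: S_def)
  have interval: "int i * p \<le> 6 * \<rho> a" "6 * \<rho> a < (int i + 1) * p" if "a \<in> S" for a
  proof -
    have "6 * \<rho> a div p = int i" using that \<rho>[of a] p1 by (auto simp: S_def h_def pos_imp_zdiv_nonneg_iff)
    then have e: "int i * p + 6 * \<rho> a mod p = 6 * \<rho> a"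
      using div_mult_mod_eq[of "6 * \<rho> a" p] by simp
    have "0 \<le> 6 * \<rho> a mod p" "6 * \<rho> a mod p < p" using p1 by simp_all
    then show "int i * p \<le> 6 * \<rho> a" "6 * \<rho> a < (int i + 1) * p"
      using e unfolding distrib_right by linarith+
  qed
  have sum_interval: "int (length l) * (int i * p) \<le> 6 * sum_list (map \<rho> l) \<and>
    (l \<noteq> [] \<longrightarrow> 6 * sum_list (map \<rho> l) < int (length l) * ((int i + 1) * p))" if "set l \<subseteq> S" for l
    using that
  proof (induction l)
    case (Cons a l)
    have "int i * p \<le> 6 * \<rho> a" "6 * \<rho> a < (int i + 1) * p" using interval Cons.prems by auto
    then show ?case using Cons by (cases "l = []") (simp_all add: distrib_right)
  qed simp
  have cong: "[sum_list (map \<rho> l) = q * \<phi> (sum_list l)] (mod p)" for l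
    by (induction l) (auto simp: \<phi>.zero \<phi>.add distrib_left \<rho>_def intro!: cong_add)
  have main: "int N dvd sum_list (map \<rho> l1) - sum_list (map \<rho> l2) \<longleftrightarrow> sum_list l1 = sum_list l2"
    if l: "set l1 \<subseteq> S" "set l2 \<subseteq> S" "length l1 = 6" "length l2 = 6" for l1 l2
  proof -
    define s where "s = sum_list (map \<rho> l1) - sum_list (map \<rho> l2)"
    define x where "x = sum_list l1 - sum_list l2"
    have ne: "l1 \<noteq> []" "l2 \<noteq> []" using l by auto
    have "int 6 * (int i * p) \<le> 6 * sum_list (map \<rho> l1)" "int 6 * (int i * p) \<le> 6 * sum_list (map \<rho> l2)"
      "6 * sum_list (map \<rho> l1) < int 6 * ((int i + 1) * p)" "6 * sum_list (map \<rho> l2) < int 6 * ((int i + 1) * p)"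
      using sum_interval[OF l(1)] sum_interval[OF l(2)] ne unfolding l(3,4) by blast+
    moreover have "\<bar>u - v\<bar> < p" if "6 * y \<le> 6 * u" "6 * y \<le> 6 * v" "6 * u < 6 * (y + p)" "6 * v < 6 * (y + p)"
      for u v y :: int using that by auto
    \<comment> \<open>Both six-term sums lie between \<open>i * p\<close> and
      \<open>(i + 1) * p\<close>. Hence a nonnegative \<open>s\<close> is its own residue modulo
      \<open>p\<close>, to which the choice of \<open>q\<close> applies.\<close>
    ultimately have sp: "\<bar>s\<bar> < p" unfolding s_def distrib_right of_nat_numeral mult_1 by blast
    have "x = sum_list l1 + (- sum_list l2)" by (simp add: x_def)
    moreover have "sum_list l1 \<in> iterated_sumset 6 A" "sum_list l2 \<in> iterated_sumset 6 A"
      using sum_list_in_iterated_sumset[of l1 A] sum_list_in_iterated_sumset[of l2 A] l S by auto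
    ultimately have xD: "x \<in> D" unfolding D_def by (simp only: set_plus_intro imageI)
    have sx: "[s = q * \<phi> x] (mod p)"
      unfolding s_def x_def \<phi>.diff right_diff_distrib by (intro cong_diff cong)
    have "x = 0" if dvd: "int N dvd s"
    proof (rule ccontr)
      assume "x \<noteq> 0"
      show False
      proof (cases "s \<ge> 0")
        case True
        then have "s mod p = s" using sp by (intro mod_pos_pos_trivial) auto
        then have "q * \<phi> x mod p = s" using sx by (simp only: cong_def)
        then show False using q[OF xD \<open>x \<noteq> 0\<close>] dvd by simp
      next
        case False
        then have "(- s) mod p = - s" using sp by (intro mod_pos_pos_trivial) auto
        \<comment> \<open>A negative \<open>s\<close> is handled through \<open>- x\<close>, which
          lies in the symmetric set \<open>D\<close>.\<close>
        moreover have "[- s = q * \<phi> (- x)] (mod p)" using sx by (simp add: \<phi>.minus cong_minus_minus_iff)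
        ultimately have "q * \<phi> (- x) mod p = - s" by (simp only: cong_def)
        then show False using q[of "- x"] Dminus[OF xD] \<open>x \<noteq> 0\<close> dvd by simp
      qed
    qed
    moreover have "s = 0" if "x = 0"
    proof -
      have "p dvd s" using sx that by (simp add: \<phi>.zero cong_0_iff)
      then show ?thesis using sp zdvd_not_zless[of "\<bar>s\<bar>" p] by force
    qed
    ultimately have "int N dvd s \<longleftrightarrow> x = 0" by auto
    then show ?thesis unfolding s_def x_def by simp
  qed
  show ?thesis by (rule that[OF S main])
qed

text \<open>Order six is needed to lift the progression from residues modulo \<open>N\<close>:
  \<open>w (k + 1) - w k - w 1\<close> lies in \<open>6A - 6A\<close>.\<close>

lemma progression_in_difference_set:
  fixes A :: "'a::ab_group_add set" and \<phi> :: "'a \<Rightarrow> int"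
  defines "D \<equiv> iterated_sumset 6 A + uminus ` iterated_sumset 6 A"
  assumes A: "finite A" "A \<noteq> {}" and c: "card D \<le> c * card A"
    and \<phi>: "\<And>x y. \<phi> (x + y) = \<phi> x + \<phi> y" and \<phi>D: "\<And>x. x \<in> D \<Longrightarrow> \<phi> x = 0 \<Longrightarrow> x = 0"
    and M: "4 \<le> M" "M ^ (4 * (6 * (c + 1))\<^sup>2) \<le> card A"
  shows "\<exists>w :: nat \<Rightarrow> 'a. w 0 = 0 \<and> w 1 \<noteq> 0 \<and>
    (\<forall>k < M div 4. w (Suc k) = w k + w 1) \<and>
    (\<forall>k \<le> M div 4. \<exists>a\<in>A. \<exists>b\<in>A. \<exists>c\<in>A. \<exists>d\<in>A. w k = a + b - c - d)"
proof -
  \<comment> \<open>The least modulus that \<open>freiman_model\<close> admits; it keeps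
    \<open>N \<le> (c + 1) * card A\<close>, so the image of \<open>S\<close> has density at least
    \<open>1 / (6 * (c + 1))\<close> modulo \<open>N\<close>.\<close>
  define N where "N = card D + 1"
  have DN: "card D < N" by (simp add: N_def)
  obtain S and \<rho> :: "'a \<Rightarrow> int" where S: "S \<subseteq> A" "card A \<le> 6 * card S" and
    iso: "\<And>l1 l2. set l1 \<subseteq> S \<Longrightarrow> set l2 \<subseteq> S \<Longrightarrow> length l1 = 6 \<Longrightarrow> length l2 = 6 \<Longrightarrow>
      int N dvd sum_list (map \<rho> l1) - sum_list (map \<rho> l2) \<longleftrightarrow> sum_list l1 = sum_list l2"
    using freiman_model[OF A DN[unfolded D_def] \<phi> \<phi>D[unfolded D_def]] by blast
  have cA: "card A > 0" using A by (simp add: card_gt_0_iff)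
  then have finS: "finite S" and S0: "S \<noteq> {}" using S A finite_subset by auto
  \<comment> \<open>\<open>z\<close> pads shorter relations to the six-term sums that
    \<open>iso\<close> compares.\<close>
  obtain z where z: "z \<in> S" using S0 by blast
  have inj: "a = b" if "a \<in> S" "b \<in> S" "int N dvd \<rho> a - \<rho> b" for a b
    using iso[of "[a, z, z, z, z, z]" "[b, z, z, z, z, z]"] that z by simp
  have "card A \<le> card D"
  proof -
    have "D = A + (iterated_sumset 5 A + uminus ` iterated_sumset 6 A)"
      unfolding D_def by (simp add: eval_nat_numeral add.assoc)
    then show ?thesis using A by (simp add: card_sumset_ge_left)
  qed
  then have MN: "M ^ (4 * (6 * (c + 1))\<^sup>2) < N" using M by (simp add: N_def)
  have "N \<le> (c + 1) * card A" using c cA by (simp add: N_def)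
  also have "\<dots> \<le> (c + 1) * (6 * card S)" using S by (intro mult_left_mono) auto
  finally have NS: "N \<le> 6 * (c + 1) * card S" by (simp add: mult_ac)
  have M0: "M > 0" using M by simp
  obtain t :: int where t: "\<not> int N dvd t" and
    tk: "\<And>k. k \<le> M div 4 \<Longrightarrow>
      \<exists>a\<in>S. \<exists>b\<in>S. \<exists>c\<in>S. \<exists>d\<in>S. int N dvd \<rho> a + \<rho> b - \<rho> c - \<rho> d - int k * t"
    using bogolyubov_progression[of S N \<rho>, OF finS S0 inj NS M0 MN] by blast
  then obtain a b c d where q: "a k \<in> S" "b k \<in> S" "c k \<in> S" "d k \<in> S"
    "int N dvd \<rho> (a k) + \<rho> (b k) - \<rho> (c k) - \<rho> (d k) - int k * t" if "k \<le> M div 4" for k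
    by metis
  define w where "w k = a k + b k - c k - d k" for k
  have "w 0 = 0"
    using iso[of "[a 0, b 0, z, z, z, z]" "[c 0, d 0, z, z, z, z]"] q[of 0] z
    by (simp add: w_def algebra_simps)
  moreover have "w 1 \<noteq> 0"
  proof
    assume "w 1 = 0"
    then have "int N dvd \<rho> (a 1) + \<rho> (b 1) - \<rho> (c 1) - \<rho> (d 1)"
      using iso[of "[a 1, b 1, z, z, z, z]" "[c 1, d 1, z, z, z, z]"] q[of 1] z M(1)
      by (simp add: w_def algebra_simps)
    then have "int N dvd t" using q(5)[of 1] M(1) by (simp add: dvd_diff_right_iff)
    then show False using t by simp
  qed
  moreover have "w (Suc k) = w k + w 1" if k: "k < M div 4" for k
  proof -
    let ?e = "\<lambda>k. \<rho> (a k) + \<rho> (b k) - \<rho> (c k) - \<rho> (d k) - int k * t"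
    let ?l1 = "[a (Suc k), b (Suc k), c k, d k, c 1, d 1]"
    let ?l2 = "[c (Suc k), d (Suc k), a k, b k, a 1, b 1]"
    have le: "Suc k \<le> M div 4" "k \<le> M div 4" "1 \<le> M div 4" using k M(1) by auto
    have "int N dvd ?e (Suc k) - ?e k - ?e 1"
      by (rule dvd_diff[OF dvd_diff[OF q(5)[OF le(1)] q(5)[OF le(2)]] q(5)[OF le(3)]])
    also have "?e (Suc k) - ?e k - ?e 1 = sum_list (map \<rho> ?l1) - sum_list (map \<rho> ?l2)"
      by (simp add: algebra_simps)
    finally have "sum_list ?l1 = sum_list ?l2"
      using iso[of ?l1 ?l2] q(1-4)[OF le(1)] q(1-4)[OF le(2)] q(1-4)[OF le(3)] by simp
    then show ?thesis by (simp add: w_def algebra_simps)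
  qed
  moreover have "\<exists>a\<in>A. \<exists>b\<in>A. \<exists>c\<in>A. \<exists>d\<in>A. w k = a + b - c - d" if "k \<le> M div 4" for k
    using q[OF that] S(1) unfolding w_def by blast
  ultimately show ?thesis by (intro exI[of _ w]) blast
qed

section \<open>Dilation by the square root of two on the integer lattice\<close>

text \<open>The pair \<open>(x, y)\<close> stands for \<open>x + y * sqrt 2\<close>.\<close>

definition sqrt2_mult :: "int \<times> int \<Rightarrow> int \<times> int" where
  "sqrt2_mult z = (2 * snd z, fst z)"

abbreviation dilate_sum :: "(int \<times> int) set \<Rightarrow> (int \<times> int) set" where
  "dilate_sum A \<equiv> A + sqrt2_mult ` A"

lemma sqrt2_mult_add: "sqrt2_mult (x + y) = sqrt2_mult x + sqrt2_mult y"
  by (simp add: sqrt2_mult_def)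

lemma inj_sqrt2_mult: "inj sqrt2_mult"
  by (auto simp: inj_def sqrt2_mult_def prod_eq_iff)

lemma image_sumset_additive:
  assumes "\<And>x y. f (x + y) = f x + f y"
  shows "f ` (A + B) = f ` A + f ` B"
proof
  show "f ` (A + B) \<subseteq> f ` A + f ` B"
    by (auto elim!: set_plus_elim simp: assms intro!: set_plus_intro)
  show "f ` A + f ` B \<subseteq> f ` (A + B)"
    by (auto elim!: set_plus_elim simp flip: assms)
qed

text \<open>Applied to multiplications by elements of the ring Z[sqrt 2], which commute with
  \<open>sqrt2_mult\<close>: normalising \<open>A\<close> by them preserves the quantity to be
  bounded.\<close>

lemma card_dilate_sum_image:
  assumes "inj f" "\<And>x y. f (x + y) = f x + f y" "\<And>x. f (sqrt2_mult x) = sqrt2_mult (f x)"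
  shows "card (dilate_sum (f ` A)) = card (dilate_sum A)"
proof -
  have "sqrt2_mult ` f ` A = f ` sqrt2_mult ` A" using assms(3) by (auto simp: image_image)
  then have "dilate_sum (f ` A) = f ` dilate_sum A"
    using image_sumset_additive[of f A "sqrt2_mult ` A"] assms(2) by simp
  then show ?thesis using assms(1) by (simp add: card_image inj_on_subset)
qed

text \<open>\<open>L\<close> lies in the kernel of \<open>g\<close>, so its translates by one
  representative from each fibre of \<open>g\<close> on \<open>A\<close> are disjoint. For a
  coordinate map \<open>g\<close> this bounds the number of rows or columns.\<close>

lemma card_image_mult_card_le:
  fixes A L :: "'a::ab_group_add set" and g :: "'a \<Rightarrow> 'b::ab_group_add"
  assumes "finite A" "finite L" "\<And>x y. g (x + y) = g x + g y" "\<And>x. x \<in> L \<Longrightarrow> g x = 0"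
  shows "card (g ` A) * card L \<le> card (A + L)"
proof -
  define r where "r = inv_into A g"
  have r: "r s \<in> A" "g (r s) = s" if "s \<in> g ` A" for s
    using that unfolding r_def by (rule inv_into_into, rule f_inv_into_f)
  have "inj_on (\<lambda>(s, l). r s + l) (g ` A \<times> L)"
  proof (rule inj_onI)
    fix x y assume "x \<in> g ` A \<times> L" "y \<in> g ` A \<times> L" and e: "(\<lambda>(s, l). r s + l) x = (\<lambda>(s, l). r s + l) y"
    then have x: "fst x \<in> g ` A" "snd x \<in> L" and y: "fst y \<in> g ` A" "snd y \<in> L" by auto
    have e': "r (fst x) + snd x = r (fst y) + snd y" using e by (simp add: case_prod_unfold)
    then have "g (r (fst x)) + g (snd x) = g (r (fst y)) + g (snd y)" by (simp only: flip: assms(3))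
    then have "fst x = fst y" using r(2)[OF x(1)] r(2)[OF y(1)] assms(4)[OF x(2)] assms(4)[OF y(2)] by simp
    then show "x = y" using e' by (simp add: prod_eq_iff)
  qed
  moreover have "(\<lambda>(s, l). r s + l) ` (g ` A \<times> L) \<subseteq> A + L" using r(1) by auto
  ultimately have "card (g ` A \<times> L) \<le> card (A + L)"
    using assms by (intro card_inj_on_le) auto
  then show ?thesis by (simp add: card_cartesian_product)
qed

text \<open>Irrationality of \<open>sqrt 2\<close>, by the parity of the exponent of 2.\<close>

lemma norm_form_nonzero:
  fixes p q :: int
  assumes "(p, q) \<noteq> 0"
  shows "p\<^sup>2 - 2 * q\<^sup>2 \<noteq> 0"
proof
  assume "p\<^sup>2 - 2 * q\<^sup>2 = 0"
  then have e: "p\<^sup>2 = 2 * q\<^sup>2" by simp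
  have "q \<noteq> 0" using e assms by (auto simp: zero_prod_def)
  then have "p \<noteq> 0" using e by auto
  have "multiplicity 2 (p\<^sup>2) = 2 * multiplicity 2 p"
    using \<open>p \<noteq> 0\<close> by (intro prime_elem_multiplicity_power_distrib) auto
  moreover have "multiplicity 2 (2 * q\<^sup>2) = 1 + 2 * multiplicity 2 q"
    using \<open>q \<noteq> 0\<close> by (simp add: prime_elem_multiplicity_mult_distrib prime_elem_multiplicity_power_distrib)
  ultimately have "2 * multiplicity 2 p = 1 + 2 * multiplicity 2 q" using e by metis
  then show False by presburger
qed

section \<open>Bounding the number of rows and columns\<close>

text \<open>For \<open>fst x + M * snd x\<close> with \<open>M\<close> larger than all first
  coordinates in \<open>D\<close>, vanishing makes \<open>M\<close> divide \<open>fst x\<close>, so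
  both coordinates are 0. This supplies the map \<open>\<phi>\<close> of the modelling
  lemma.\<close>

lemma exists_injective_functional:
  fixes D :: "(int \<times> int) set"
  assumes "finite D"
  shows "\<exists>\<phi> :: int \<times> int \<Rightarrow> int. (\<forall>x y. \<phi> (x + y) = \<phi> x + \<phi> y) \<and> (\<forall>x\<in>D. \<phi> x = 0 \<longrightarrow> x = 0)"
proof -
  define M where "M = Max ((\<lambda>x. \<bar>fst x\<bar>) ` insert 0 D) + 1"
  have M: "\<bar>fst x\<bar> < M" if "x \<in> insert 0 D" for x
    using Max_ge[of "(\<lambda>x. \<bar>fst x\<bar>) ` insert 0 D" "\<bar>fst x\<bar>"] that assms unfolding M_def by auto
  have M0: "M > 0" using M[of 0] by simp
  have "x = 0" if x: "x \<in> D" "fst x + M * snd x = 0" for x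
  proof -
    have "M dvd fst x" using x(2) by (metis dvd_add_left_iff dvd_0_right dvd_triv_left)
    then have "fst x = 0" using M[of x] x(1) zdvd_imp_le[of M "\<bar>fst x\<bar>"] by fastforce
    then show "x = 0" using x(2) M0 by (simp add: prod_eq_iff)
  qed
  then show ?thesis by (intro exI[of _ "\<lambda>x. fst x + M * snd x"]) (auto simp: algebra_simps)
qed

text \<open>The progression \<open>L\<close> in \<open>2A - 2A\<close> runs along
  \<open>w 1\<close>. Multiplication by the conjugate of \<open>w 1\<close> makes \<open>L\<close>
  horizontal and its dilate vertical, so \<open>A + L\<close> has \<open>card L\<close> points for
  each row and \<open>A\<close> plus the dilate has as many for each column; both sums have size
  \<open>O(|A|)\<close>.\<close>

lemma few_lines:
  obtains C \<epsilon> :: real where "C > 0" "\<epsilon> > 0" "\<epsilon> \<le> 1 / 2"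
    "\<And>A. finite A \<Longrightarrow> A \<noteq> {} \<Longrightarrow> card (dilate_sum A) \<le> 6 * card A \<Longrightarrow>
      \<exists>A'. finite A' \<and> card A' = card A \<and> card (dilate_sum A') = card (dilate_sum A) \<and>
        real (card (fst ` A')) \<le> C * real (card A) powr (1 - \<epsilon>) \<and>
        real (card (snd ` A')) \<le> C * real (card A) powr (1 - \<epsilon>)"
proof -
  \<comment> \<open>\<open>6 ^ 12\<close> is the Pluennecke-Ruzsa constant of
    \<open>6A - 6A\<close>; \<open>d\<close> is the exponent demanded by
    \<open>progression_in_difference_set\<close>, and \<open>\<epsilon> = 1 / d\<close> ensures
    \<open>M ^ d \<le> card A\<close>. In \<open>C\<close>, \<open>6 ^ 6\<close> bounds the sum of
    \<open>A\<close> and the dilate of \<open>L\<close>, and 4 comes from the size of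
    \<open>L\<close>.\<close>
  define c where "c = (6::nat) ^ 12"
  define d where "d = 4 * (6 * (c + 1))\<^sup>2"
  define \<epsilon> where "\<epsilon> = 1 / real d"
  define C where "C = 4 * (6::real) ^ 6"
  have d: "d \<ge> 2" by (simp add: d_def power2_eq_square)
  then have \<epsilon>: "\<epsilon> > 0" "\<epsilon> \<le> 1 / 2" by (auto simp: \<epsilon>_def field_simps)
  have "\<exists>A'. finite A' \<and> card A' = card A \<and> card (dilate_sum A') = card (dilate_sum A) \<and>
        real (card (fst ` A')) \<le> C * real (card A) powr (1 - \<epsilon>) \<and>
        real (card (snd ` A')) \<le> C * real (card A) powr (1 - \<epsilon>)"
    if A: "finite A" "A \<noteq> {}" and small: "card (dilate_sum A) \<le> 6 * card A" for A
  proof -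
    define a where "a = real (card A)"
    have a1: "a \<ge> 1" using A by (simp add: a_def Suc_le_eq card_gt_0_iff)
    define M where "M = nat \<lfloor>a powr \<epsilon>\<rfloor>"
    have M: "real M \<le> a powr \<epsilon>" "a powr \<epsilon> < real M + 1" by (simp_all add: M_def)
    have asplit: "a = a powr \<epsilon> * a powr (1 - \<epsilon>)" using a1 by (simp flip: powr_add)
    have cT: "card (sqrt2_mult ` A) = card A" by (simp add: card_image inj_on_subset[OF inj_sqrt2_mult])
    \<comment> \<open>The dilate of \<open>A\<close>, which has the same size as \<open>A\<close>,
      is the base set, and \<open>A\<close> is the repeated summand.\<close>
    have pr: "real (card (iterated_sumset j A + uminus ` iterated_sumset k A)) \<le> 6 ^ (j + k) * a" for j k
    proof -
      have "real (card (sqrt2_mult ` A + A)) \<le> 6 * real (card (sqrt2_mult ` A))"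
        using small cT by (simp add: add.commute)
      then show ?thesis
        using pluennecke_ruzsa[of "sqrt2_mult ` A" A 6 j k] A cT by (simp add: a_def)
    qed
    show ?thesis
    proof (cases "M < 4")
      case True
      have "a powr \<epsilon> \<le> 4" using M True by linarith
      then have "a powr \<epsilon> * a powr (1 - \<epsilon>) \<le> 4 * a powr (1 - \<epsilon>)" by (intro mult_right_mono) auto
      then have "a \<le> 4 * a powr (1 - \<epsilon>)" using asplit by simp
      also have "\<dots> \<le> C * a powr (1 - \<epsilon>)" by (intro mult_right_mono) (auto simp: C_def)
      finally have "a \<le> C * a powr (1 - \<epsilon>)" .
      moreover have "real (card (fst ` A)) \<le> a" "real (card (snd ` A)) \<le> a"
        using A by (simp_all add: a_def card_image_le)
      ultimately show ?thesis using A by (intro exI[of _ A]) (auto simp: a_def)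
    next
      case False
      let ?D = "iterated_sumset 6 A + uminus ` iterated_sumset 6 A"
      have "real (card ?D) \<le> real (c * card A)" using pr[of 6 6] by (simp add: c_def a_def)
      then have cD: "card ?D \<le> c * card A" by (simp only: of_nat_le_iff)
      have "real M powr real d \<le> (a powr \<epsilon>) powr real d"
        using M(1) by (intro powr_mono2) auto
      also have "\<dots> = a" using a1 d by (simp add: powr_powr \<epsilon>_def)
      finally have "real (M ^ d) \<le> real (card A)" using False by (simp add: powr_realpow a_def)
      then have Md: "M ^ (4 * (6 * (c + 1))\<^sup>2) \<le> card A" unfolding d_def by (simp only: of_nat_le_iff)
      have finD: "finite ?D" using A by simp
      obtain \<phi> :: "int \<times> int \<Rightarrow> int" where \<phi>: "\<And>x y. \<phi> (x + y) = \<phi> x + \<phi> y"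
          "\<And>x. x \<in> ?D \<Longrightarrow> \<phi> x = 0 \<Longrightarrow> x = 0"
        using exists_injective_functional[OF finD] by blast
      have M4: "4 \<le> M" using False by simp
      obtain w :: "nat \<Rightarrow> int \<times> int" where w: "w 0 = 0" "w 1 \<noteq> 0"
          "\<And>k. k < M div 4 \<Longrightarrow> w (Suc k) = w k + w 1"
          "\<And>k. k \<le> M div 4 \<Longrightarrow> \<exists>a\<in>A. \<exists>b\<in>A. \<exists>c\<in>A. \<exists>d\<in>A. w k = a + b - c - d"
        using progression_in_difference_set[OF A cD \<phi> M4 Md] by blast
      obtain p q where pq: "w 1 = (p, q)" by (cases "w 1")
      have wk: "w k = (int k * p, int k * q)" if "k \<le> M div 4" for k
        using that
      proof (induction k)
        case 0
        then show ?case using w(1) by (simp add: zero_prod_def)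
      next
        case (Suc k)
        then have "w (Suc k) = (int k * p, int k * q) + (p, q)" using w(3)[of k] pq by simp
        then show ?case by (simp add: algebra_simps)
      qed
      define L where "L = w ` {..M div 4}"
      have finL: "finite L" by (simp add: L_def)
      have "inj_on w {..M div 4}"
        using w(2) unfolding pq by (intro inj_onI) (auto simp: wk zero_prod_def)
      \<comment> \<open>\<open>L\<close> has \<open>M div 4 + 1 \<ge> (M + 1) / 4\<close> elements,
        and \<open>M + 1\<close> exceeds \<open>a powr \<epsilon>\<close>.\<close>
      then have cardL: "a powr \<epsilon> / 4 \<le> real (card L)"
        using M(2) by (simp add: L_def card_image)
      have L: "\<exists>a\<in>A. \<exists>b\<in>A. \<exists>c\<in>A. \<exists>d\<in>A. x = a + b - c - d" if "x \<in> L" for x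
        using that w(4) by (auto simp: L_def)
      have it: "iterated_sumset 3 A = A + (A + A)" "iterated_sumset 2 A = A + A"
        by (simp_all add: eval_nat_numeral flip: set_zero)
      have sub: "A + L \<subseteq> iterated_sumset 3 A + uminus ` iterated_sumset 2 A"
      proof
        fix x assume "x \<in> A + L"
        then obtain y a b c d where "y \<in> A" "a \<in> A" "b \<in> A" "c \<in> A" "d \<in> A" "x = y + (a + b - c - d)"
          using L by (metis set_plus_elim)
        moreover from this have x: "x = (y + (a + b)) + (- (c + d))" by simp
        ultimately show "x \<in> iterated_sumset 3 A + uminus ` iterated_sumset 2 A"
          unfolding it x by (intro set_plus_intro imageI)
      qed
      have sub': "A + uminus ` L \<subseteq> iterated_sumset 3 A + uminus ` iterated_sumset 2 A"
      proof
        fix x assume "x \<in> A + uminus ` L"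
        then obtain y l where "y \<in> A" "l \<in> L" "x = y - l" by (auto elim!: set_plus_elim)
        moreover obtain a b c d where "a \<in> A" "b \<in> A" "c \<in> A" "d \<in> A" "l = a + b - c - d"
          using L[OF \<open>l \<in> L\<close>] by blast
        moreover from calculation have x: "x = (y + (c + d)) + (- (a + b))" by simp
        ultimately show "x \<in> iterated_sumset 3 A + uminus ` iterated_sumset 2 A"
          unfolding it x by (intro set_plus_intro imageI)
      qed
      have fin32: "finite (iterated_sumset 3 A + uminus ` iterated_sumset 2 A)" using A by simp
      have AL: "real (card (A + L)) \<le> 6 ^ 5 * a"
        using card_mono[OF fin32 sub] pr[of 3 2] by simp
      have AL': "real (card (A + uminus ` L)) \<le> 6 ^ 5 * a"
        using card_mono[OF fin32 sub'] pr[of 3 2] by simp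
      \<comment> \<open>Triangle inequality through the dilate of \<open>A\<close>: its sum with
        \<open>A\<close> is small by assumption, and its difference with the dilate of
        \<open>L\<close> has the size of \<open>A - L\<close>.\<close>
      have ATL: "real (card (A + sqrt2_mult ` L)) \<le> 6 ^ 6 * a"
      proof -
        have um: "sqrt2_mult ` uminus ` L = uminus ` sqrt2_mult ` L"
          by (auto simp: image_image sqrt2_mult_def)
        have "card (sqrt2_mult ` A) * card (A + uminus ` (sqrt2_mult ` uminus ` L))
            \<le> card (sqrt2_mult ` A + A) * card (sqrt2_mult ` A + sqrt2_mult ` uminus ` L)"
          using A finL by (intro ruzsa_triangle) auto
        moreover have "uminus ` (sqrt2_mult ` uminus ` L) = sqrt2_mult ` L"
          unfolding um by (simp add: image_image)
        moreover have "card (sqrt2_mult ` A + sqrt2_mult ` uminus ` L) = card (A + uminus ` L)"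
          unfolding image_sumset_additive[OF sqrt2_mult_add, symmetric]
          by (simp add: card_image inj_on_subset[OF inj_sqrt2_mult])
        ultimately have "card A * card (A + sqrt2_mult ` L) \<le> card (dilate_sum A) * card (A + uminus ` L)"
          by (simp add: cT add.commute)
        then have "a * real (card (A + sqrt2_mult ` L)) \<le> real (card (dilate_sum A)) * real (card (A + uminus ` L))"
          unfolding a_def by (simp only: of_nat_mult[symmetric] of_nat_le_iff)
        also have "\<dots> \<le> (6 * a) * (6 ^ 5 * a)"
          using small AL' by (intro mult_mono) (auto simp: a_def)
        also have "\<dots> = a * (6 ^ 6 * a)" by simp
        finally show ?thesis using a1 by simp
      qed
      \<comment> \<open>multiplication by the conjugate of \<open>w 1\<close>\<close>
      define J where "J z = (p * fst z - 2 * q * snd z, p * snd z - q * fst z)" for z :: "int \<times> int"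
      have nz: "p\<^sup>2 - 2 * q\<^sup>2 \<noteq> 0" using w(2) pq norm_form_nonzero by simp
      have Jadd: "J (x + y) = J x + J y" for x y by (simp add: J_def algebra_simps)
      have JT: "J (sqrt2_mult x) = sqrt2_mult (J x)" for x
        by (simp add: J_def sqrt2_mult_def algebra_simps)
      have injJ: "inj J"
      proof (rule injI)
        fix x y assume "J x = J y"
        then have 1: "p * fst x - 2 * q * snd x = p * fst y - 2 * q * snd y"
          and 2: "p * snd x - q * fst x = p * snd y - q * fst y" by (simp_all add: J_def)
        have "(p\<^sup>2 - 2 * q\<^sup>2) * fst x = (p\<^sup>2 - 2 * q\<^sup>2) * fst y"
          using 1 2 by algebra
        moreover have "(p\<^sup>2 - 2 * q\<^sup>2) * snd x = (p\<^sup>2 - 2 * q\<^sup>2) * snd y"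
          using 1 2 by algebra
        ultimately show "x = y" using nz by (simp add: prod_eq_iff)
      qed
      have bound: "real r \<le> C * a powr (1 - \<epsilon>)" if "real (r * card L) \<le> 6 ^ 6 * a" for r :: nat
      proof -
        have "a powr \<epsilon> * real r \<le> a powr \<epsilon> * (C * a powr (1 - \<epsilon>))"
        proof -
          have "(a powr \<epsilon> / 4) * real r \<le> real (card L) * real r"
            using cardL by (intro mult_right_mono) auto
          also have "\<dots> \<le> 6 ^ 6 * (a powr \<epsilon> * a powr (1 - \<epsilon>))" using that asplit by (simp add: mult.commute)
          finally show ?thesis by (simp add: C_def)
        qed
        then show ?thesis using a1 by simp
      qed
      have "real (card (snd ` J ` A)) \<le> C * a powr (1 - \<epsilon>)"
      proof (rule bound)
        have "card ((snd \<circ> J) ` A) * card L \<le> card (A + L)"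
          proof (rule card_image_mult_card_le[OF A(1) finL])
            show "(snd \<circ> J) x = 0" if "x \<in> L" for x using that by (auto simp: L_def wk J_def)
          qed (simp add: Jadd)
        then have "real (card (snd ` J ` A) * card L) \<le> real (card (A + L))"
          by (simp only: image_comp of_nat_le_iff)
        then show "real (card (snd ` J ` A) * card L) \<le> 6 ^ 6 * a" using AL a1 by simp
      qed
      moreover have "real (card (fst ` J ` A)) \<le> C * a powr (1 - \<epsilon>)"
      proof (rule bound)
        have "card ((fst \<circ> J) ` A) * card (sqrt2_mult ` L) \<le> card (A + sqrt2_mult ` L)"
        proof (rule card_image_mult_card_le[OF A(1) finite_imageI[OF finL]])
          show "(fst \<circ> J) x = 0" if "x \<in> sqrt2_mult ` L" for x
            using that by (auto simp: L_def wk J_def sqrt2_mult_def)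
        qed (simp add: Jadd)
        moreover have "card (sqrt2_mult ` L) = card L"
          by (simp add: card_image inj_on_subset[OF inj_sqrt2_mult])
        ultimately have "real (card (fst ` J ` A) * card L) \<le> real (card (A + sqrt2_mult ` L))"
          by (simp only: image_comp of_nat_le_iff)
        then show "real (card (fst ` J ` A) * card L) \<le> 6 ^ 6 * a" using ATL by simp
      qed
      moreover have "card (J ` A) = card A" by (simp add: card_image inj_on_subset[OF injJ])
      moreover have "card (dilate_sum (J ` A)) = card (dilate_sum A)"
        by (rule card_dilate_sum_image[OF injJ Jadd JT])
      ultimately show ?thesis using A by (intro exI[of _ "J ` A"]) (simp add: a_def)
    qed
  qed
  then show ?thesis using that[of C \<epsilon>] \<epsilon> by (auto simp: C_def)
qed

section \<open>Splitting by the parity of the first coordinate\<close>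

lemma dilate_sum_translate:
  "card (dilate_sum (A + {v})) = card (dilate_sum A)"
proof -
  have "sqrt2_mult ` (A + {v}) = sqrt2_mult ` A + {sqrt2_mult v}"
    by (simp add: image_sumset_additive sqrt2_mult_add)
  then have "dilate_sum (A + {v}) = (dilate_sum A + {v}) + {sqrt2_mult v}"
    by (simp only: ac_simps)
  then show ?thesis by simp
qed

text \<open>As long as all first coordinates are even, \<open>A\<close> can be divided by \<open>sqrt2_mult\<close>, which swaps the
  roles of rows and columns and halves the form \<open>x\<^sup>2 + 2 y\<^sup>2\<close>.\<close>

lemma both_parities_aux:
  assumes "finite A" "0 \<in> A" "card A \<ge> 2" "card (fst ` A) \<le> R" "card (snd ` A) \<le> R"
  shows "\<exists>A'. finite A' \<and> card A' = card A \<and> card (dilate_sum A') = card (dilate_sum A) \<and>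
    card (fst ` A') \<le> R \<and> card (snd ` A') \<le> R \<and>
    (\<exists>x\<in>A'. even (fst x)) \<and> (\<exists>x\<in>A'. odd (fst x))"
  using assms
proof (induction "\<Sum>z\<in>A. nat ((fst z)\<^sup>2 + 2 * (snd z)\<^sup>2)" arbitrary: A rule: less_induct)
  case less
  show ?case
  proof (cases "\<exists>x\<in>A. odd (fst x)")
    case True
    \<comment> \<open>The invariant \<open>0 \<in> A\<close> supplies the point with even first
      coordinate.\<close>
    then show ?thesis using less.prems by (intro exI[of _ A]) (auto intro!: bexI[of _ 0])
  next
    case False
    define h where "h z = (snd z, fst z div 2)" for z :: "int \<times> int"
    define B where "B = h ` A"
    have Th: "sqrt2_mult (h z) = z" if "z \<in> A" for z
      using False that by (auto simp: sqrt2_mult_def h_def prod_eq_iff)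
    have TB: "sqrt2_mult ` B = A" using Th by (auto simp: B_def image_image)
    have inj: "inj_on h A" using Th by (metis inj_onI)
    have cB: "card B = card A" by (simp add: B_def card_image[OF inj])
    have "card (dilate_sum A) = card (dilate_sum B)"
      using card_dilate_sum_image[OF inj_sqrt2_mult sqrt2_mult_add refl, of B] TB by simp
    moreover have "fst ` B = snd ` A" by (auto simp: B_def h_def image_image)
    moreover have "snd ` B = (\<lambda>x. x div 2) ` fst ` A" by (auto simp: B_def h_def image_image)
    then have "card (snd ` B) \<le> R"
      using card_image_le[of "fst ` A" "\<lambda>x. x div 2"] less.prems by simp
    moreover have "0 \<in> B" using less.prems(2) by (auto simp: B_def h_def zero_prod_def image_iff intro!: bexI[of _ 0])
    moreover have "(\<Sum>z\<in>B. nat ((fst z)\<^sup>2 + 2 * (snd z)\<^sup>2)) < (\<Sum>z\<in>A. nat ((fst z)\<^sup>2 + 2 * (snd z)\<^sup>2))"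
    proof -
      have le: "nat ((fst (h z))\<^sup>2 + 2 * (snd (h z))\<^sup>2) \<le> nat ((fst z)\<^sup>2 + 2 * (snd z)\<^sup>2)"
        and lt: "z \<noteq> 0 \<Longrightarrow> nat ((fst (h z))\<^sup>2 + 2 * (snd (h z))\<^sup>2) < nat ((fst z)\<^sup>2 + 2 * (snd z)\<^sup>2)"
        if "z \<in> A" for z
      proof -
        define u v where "u = snd z" and "v = fst z div 2"
        have z: "fst z = 2 * v" "snd z = u" using False that by (auto simp: u_def v_def)
        have e: "(fst z)\<^sup>2 + 2 * (snd z)\<^sup>2 = 2 * (u\<^sup>2 + 2 * v\<^sup>2)" "(fst (h z))\<^sup>2 + 2 * (snd (h z))\<^sup>2 = u\<^sup>2 + 2 * v\<^sup>2"
          unfolding z by (simp_all add: h_def z algebra_simps power2_eq_square)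
        have nn: "0 \<le> u\<^sup>2 + 2 * v\<^sup>2" by simp
        show "nat ((fst (h z))\<^sup>2 + 2 * (snd (h z))\<^sup>2) \<le> nat ((fst z)\<^sup>2 + 2 * (snd z)\<^sup>2)"
          unfolding e by (intro nat_mono) (use nn in simp)
        assume "z \<noteq> 0"
        then have "u \<noteq> 0 \<or> v \<noteq> 0" using z by (auto simp: prod_eq_iff)
        then have "0 < u\<^sup>2 + 2 * v\<^sup>2" by (auto intro: add_pos_nonneg add_nonneg_pos)
        then show "nat ((fst (h z))\<^sup>2 + 2 * (snd (h z))\<^sup>2) < nat ((fst z)\<^sup>2 + 2 * (snd z)\<^sup>2)"
          unfolding e by (subst nat_mono_iff) simp_all
      qed
      \<comment> \<open>The form decreases strictly only at nonzero points;
        \<open>card A \<ge> 2\<close> provides one.\<close>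
      obtain z where z: "z \<in> A" "z \<noteq> 0"
      proof -
        have "\<not> A \<subseteq> {0}" using less.prems(3) card_mono[of "{0}" A] by force
        then show ?thesis using that by blast
      qed
      show ?thesis
        unfolding B_def sum.reindex[OF inj] o_def
      proof (rule sum_strict_mono_ex1)
        show "finite A" by (rule less.prems)
      qed (use le lt z in blast)+
    qed
    ultimately show ?thesis
      using less.hyps[of B] less.prems cB by (simp add: B_def)
  qed
qed

lemma both_parities:
  assumes "finite A" "card A \<ge> 2" "card (fst ` A) \<le> R" "card (snd ` A) \<le> R"
  obtains A' where "finite A'" "card A' = card A" "card (dilate_sum A') = card (dilate_sum A)"
    "card (fst ` A') \<le> R" "card (snd ` A') \<le> R" "\<exists>x\<in>A'. even (fst x)" "\<exists>x\<in>A'. odd (fst x)"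
proof -
  have "A \<noteq> {}" using assms(2) by auto
  then obtain v where v: "v \<in> A" by blast
  have "fst ` (A + {- v}) = fst ` A + {- fst v}" "snd ` (A + {- v}) = snd ` A + {- snd v}"
    by (simp_all add: image_sumset_additive)
  then have "card (fst ` (A + {- v})) \<le> R" "card (snd ` (A + {- v})) \<le> R"
    using assms by simp_all
  moreover have "0 \<in> A + {- v}" using v set_plus_intro[of v A "- v" "{- v}"] by simp
  ultimately show ?thesis
    using both_parities_aux[of "A + {- v}" R] assms that by (auto simp: dilate_sum_translate)
qed

lemma am_gm_sqrt:
  fixes x y :: real
  assumes "x \<ge> 0" "y \<ge> 0"
  shows "2 * sqrt (x * y) \<le> x + y"
  using arith_geo_mean_sqrt[OF assms] by simp

text \<open>The columns of the dilate of \<open>A\<close> correspond to the rows of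
  \<open>A\<close>. With \<open>n\<close> columns in \<open>A0\<close> and \<open>m\<close> rows in
  \<open>A\<close>, the cross terms \<open>b * m / n\<close> and \<open>a * n / m\<close> have
  product \<open>a * b\<close>, so AM-GM gives \<open>2 * sqrt (a * b)\<close> for all
  \<open>m\<close> and \<open>n\<close>. The losses are at most \<open>3 * a / m + m + n\<close>,
  and \<open>a / m \<le> R\<close> since \<open>A\<close> lies in the product of its
  projections.\<close>

lemma dilate_sum_parity_class:
  assumes A: "finite A" "A \<noteq> {}" and A0: "A0 \<subseteq> A" "A0 \<noteq> {}"
    and R: "real (card (fst ` A)) \<le> R" "real (card (snd ` A)) \<le> R"
  shows "real (card A0) + real (card A) + 2 * sqrt (real (card A0) * real (card A)) - 5 * R
    \<le> real (card (A0 + sqrt2_mult ` A))"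
proof -
  define a b m n where "a = real (card A)" and "b = real (card A0)"
    and "m = real (card (snd ` A))" and "n = real (card (fst ` A0))"
  have fin0: "finite A0" using A A0 finite_subset by blast
  have "fst ` sqrt2_mult ` A = (\<lambda>y. 2 * y) ` snd ` A" by (auto simp: sqrt2_mult_def image_image)
  then have cm: "card (fst ` sqrt2_mult ` A) = card (snd ` A)"
    by (simp add: card_image inj_on_def)
  have cT: "card (sqrt2_mult ` A) = card A" by (simp add: card_image inj_on_subset[OF inj_sqrt2_mult])
  have pos: "m \<ge> 1" "n \<ge> 1" "b \<ge> 0" "a \<ge> 0"
    using A A0 fin0 by (simp_all add: m_def n_def a_def b_def Suc_le_eq card_gt_0_iff)
  have ba: "b \<le> a" using A A0 by (simp add: a_def b_def card_mono)
  have mR: "m \<le> R" using R by (simp add: m_def)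
  have nR: "n \<le> R"
    using R(1) A A0 by (simp add: n_def) (meson card_mono finite_imageI image_mono of_nat_mono order_trans)
  have amR: "a / m \<le> R"
  proof -
    have "A \<subseteq> fst ` A \<times> snd ` A" by force
    then have "card A \<le> card (fst ` A) * card (snd ` A)"
      using card_mono[of "fst ` A \<times> snd ` A" A] A by (simp add: card_cartesian_product)
    then have "a \<le> real (card (fst ` A)) * m" unfolding a_def m_def by (metis of_nat_le_iff of_nat_mult)
    then have "a / m \<le> real (card (fst ` A))" using pos by (simp add: field_simps)
    then show ?thesis using R by simp
  qed
  have "(b / n + a / m - 1) * (n + m - 1) \<le> real (card (A0 + sqrt2_mult ` A))"
    using card_sumset_columns_ge[of A0 "sqrt2_mult ` A"] A A0 fin0
    unfolding cm cT by (simp add: a_def b_def m_def n_def)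
  moreover have "(b / n + a / m - 1) * (n + m - 1) = b + a + (b * (m - 1) / n + a * n / m) - a / m - (n + m - 1)"
    using pos by (simp add: field_simps)
  \<comment> \<open>Having \<open>m - 1\<close> instead of \<open>m\<close> costs at most a factor
    \<open>1 - 1 / m\<close>, that is \<open>2 * (a / m)\<close>, because
    \<open>sqrt (b * a) \<le> a\<close>.\<close>
  moreover have "2 * sqrt (b * a) - 2 * (a / m) \<le> b * (m - 1) / n + a * n / m"
  proof -
    have th: "0 \<le> 1 - 1 / m" "1 - 1 / m \<le> 1" using pos by simp_all
    have "(b * m / n) * (a * n / m) = b * a" using pos by simp
    then have "2 * sqrt (b * a) \<le> b * m / n + a * n / m"
      using am_gm_sqrt[of "b * m / n" "a * n / m"] pos by simp
    then have "(1 - 1 / m) * (2 * sqrt (b * a)) \<le> (1 - 1 / m) * (b * m / n + a * n / m)"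
      using th by (intro mult_left_mono)
    also have "\<dots> = b * (m - 1) / n + (1 - 1 / m) * (a * n / m)"
      using pos by (simp add: field_simps)
    also have "(1 - 1 / m) * (a * n / m) \<le> 1 * (a * n / m)"
      using th pos by (intro mult_right_mono) auto
    finally have "(1 - 1 / m) * (2 * sqrt (b * a)) \<le> b * (m - 1) / n + a * n / m" by simp
    moreover have "sqrt (b * a) \<le> a"
    proof -
      have "sqrt (b * a) \<le> sqrt (a * a)" using ba pos by (intro real_sqrt_le_mono mult_right_mono) auto
      then show ?thesis using pos by simp
    qed
    then have "sqrt (b * a) / m \<le> a / m" using pos by (intro divide_right_mono) auto
    ultimately show ?thesis by (simp add: left_diff_distrib)
  qed
  ultimately show ?thesis using mR nR amR unfolding a_def b_def by (simp add: mult.commute)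
qed

text \<open>The dilate of \<open>A\<close> has even first coordinates, so adding it preserves parity
  and the sums from the two classes are disjoint. The larger class keeps only
  \<open>dilate_sum A1\<close>, ready for induction.\<close>

lemma dilate_sum_split:
  assumes A: "finite A" "\<exists>x\<in>A. even (fst x)" "\<exists>x\<in>A. odd (fst x)"
    and R: "real (card (fst ` A)) \<le> R" "real (card (snd ` A)) \<le> R"
  obtains A0 A1 :: "(int \<times> int) set"
  where "card A0 > 0" "finite A1" "card A = card A0 + card A1" "card A0 \<le> card A1"
    "real (card (dilate_sum A1)) + real (card A0) + real (card A)
      + 2 * sqrt (real (card A0) * real (card A)) - 5 * R \<le> real (card (dilate_sum A))"
proof -
  note witness = that
  \<comment> \<open>\<open>P\<close> is \<open>even\<close> or \<open>odd\<close>, whichever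
    describes the smaller class.\<close>
  have main: thesis
    if P: "A0 = {x \<in> A. P (fst x)}" "A1 = {x \<in> A. \<not> P (fst x)}" "A0 \<noteq> {}" "card A0 \<le> card A1"
      and per: "\<And>x y. P (x + 2 * y) = P x" for P A0 A1
  proof (rule witness)
    have sub: "A0 \<subseteq> A" "A1 \<subseteq> A" and un: "A = A0 \<union> A1" and dis: "A0 \<inter> A1 = {}" using P by auto
    show fin: "finite A1" using A sub finite_subset by blast
    have fin0: "finite A0" using A sub finite_subset by blast
    show "card A0 > 0" using fin0 P by (simp add: card_gt_0_iff)
    show "card A = card A0 + card A1" using un dis fin fin0 by (simp add: card_Un_disjoint)
    show "card A0 \<le> card A1" by fact
    have "P (fst x)" if "x \<in> A0 + sqrt2_mult ` A" for x
      using that per by (auto simp: P(1) sqrt2_mult_def elim!: set_plus_elim)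
    moreover have "\<not> P (fst x)" if "x \<in> A1 + sqrt2_mult ` A" for x
      using that per by (auto simp: P(2) sqrt2_mult_def elim!: set_plus_elim)
    ultimately have "(A0 + sqrt2_mult ` A) \<inter> (A1 + sqrt2_mult ` A) = {}" by blast
    moreover have "dilate_sum A = (A0 + sqrt2_mult ` A) \<union> (A1 + sqrt2_mult ` A)"
      using un by (metis Un_set_plus)
    ultimately have "card (dilate_sum A) = card (A0 + sqrt2_mult ` A) + card (A1 + sqrt2_mult ` A)"
      using fin fin0 A by (simp add: card_Un_disjoint)
    moreover have "card (dilate_sum A1) \<le> card (A1 + sqrt2_mult ` A)"
      using A fin sub by (intro card_mono finite_sumset finite_imageI set_plus_mono2 image_mono) auto
    moreover have "real (card A0) + real (card A) + 2 * sqrt (real (card A0) * real (card A)) - 5 * R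
        \<le> real (card (A0 + sqrt2_mult ` A))"
      using A P sub by (intro dilate_sum_parity_class R) auto
    ultimately show "real (card (dilate_sum A1)) + real (card A0) + real (card A)
      + 2 * sqrt (real (card A0) * real (card A)) - 5 * R \<le> real (card (dilate_sum A))" by simp
  qed
  show ?thesis
  proof (cases "card {x \<in> A. even (fst x)} \<le> card {x \<in> A. odd (fst x)}")
    case True
    then show ?thesis using A by (intro main[of "{x \<in> A. even (fst x)}" even]) auto
  next
    case False
    then show ?thesis using A by (intro main[of "{x \<in> A. odd (fst x)}" odd]) auto
  qed
qed

section \<open>Induction on the size of the set\<close>

text \<open>The surplus factors as \<open>(1 - sqrt 2 * s) * (1 + (2 + sqrt 2) * s)\<close>. It
  vanishes at \<open>2 * s\<^sup>2 = 1\<close>, where the parity classes have equal size, and for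
  \<open>s \<le> 1 / 2\<close> the first factor is at least \<open>1 / 4\<close>.\<close>

lemma surplus_ge:
  fixes s :: real
  assumes "0 \<le> s" "2 * s\<^sup>2 \<le> 1"
  shows "(2 + 2 * sqrt 2) * s\<^sup>2 \<le> 1 + 2 * s"
    and "s \<le> 1 / 2 \<Longrightarrow> (2 + 2 * sqrt 2) * s\<^sup>2 + 1 / 4 \<le> 1 + 2 * s"
proof -
  have sq: "sqrt 2 * sqrt 2 = 2" by simp
  have id: "1 + 2 * s - (2 + 2 * sqrt 2) * s\<^sup>2 = (1 - sqrt 2 * s) * (1 + (2 + sqrt 2) * s)"
    using sq by (simp add: algebra_simps power2_eq_square)
  have one: "1 \<le> 1 + (2 + sqrt 2) * s" using assms by simp
  have "(sqrt 2 * s)\<^sup>2 \<le> 1\<^sup>2" using assms by (simp add: power_mult_distrib)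
  then have le: "sqrt 2 * s \<le> 1" by (rule power2_le_imp_le) simp
  have "0 \<le> (1 - sqrt 2 * s) * (1 + (2 + sqrt 2) * s)" using le one by (intro mult_nonneg_nonneg) auto
  then show "(2 + 2 * sqrt 2) * s\<^sup>2 \<le> 1 + 2 * s" using id by simp
  assume "s \<le> 1 / 2"
  have "sqrt 2 \<le> 3 / 2" by (rule real_le_lsqrt) (auto simp: power2_eq_square)
  then have "sqrt 2 * s \<le> (3 / 2) * (1 / 2)" using \<open>s \<le> 1 / 2\<close> assms by (intro mult_mono) auto
  then have "1 / 4 * 1 \<le> (1 - sqrt 2 * s) * (1 + (2 + sqrt 2) * s)" using one by (intro mult_mono) auto
  then show "(2 + 2 * sqrt 2) * s\<^sup>2 + 1 / 4 \<le> 1 + 2 * s" using id by simp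
qed

text \<open>Strong induction on \<open>card A\<close>. If the smaller class holds at most a quarter
  of \<open>A\<close>, the surplus is linear in \<open>card A\<close> and pays for the rows and
  columns. Otherwise the larger class holds at most three quarters, and the error term of the
  induction hypothesis shrinks by a constant factor.\<close>

lemma dilate_sum_lower_bound:
  obtains C \<epsilon> :: real where "C > 0" "\<epsilon> > 0"
    "\<And>A. finite A \<Longrightarrow> (3 + 2 * sqrt 2) * real (card A) - C * real (card A) powr (1 - \<epsilon>)
      \<le> real (card (dilate_sum A))"
proof -
  obtain B \<epsilon> where B: "B > 0" and \<epsilon>: "\<epsilon> > 0" "\<epsilon> \<le> 1 / 2" and lines:
    "\<And>A. finite A \<Longrightarrow> A \<noteq> {} \<Longrightarrow> card (dilate_sum A) \<le> 6 * card A \<Longrightarrow>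
      \<exists>A'. finite A' \<and> card A' = card A \<and> card (dilate_sum A') = card (dilate_sum A) \<and>
        real (card (fst ` A')) \<le> B * real (card A) powr (1 - \<epsilon>) \<and>
        real (card (snd ` A')) \<le> B * real (card A) powr (1 - \<epsilon>)"
    using few_lines by metis
  \<comment> \<open>\<open>120 * B\<close> serves both cases: \<open>C * e \<le> 6 * a\<close>
    yields \<open>5 * B * e \<le> a / 4\<close>, and a tenth of \<open>C * e\<close> is at least
    \<open>12 * B * e\<close>. The summand 6 makes \<open>C / 6 > 1\<close>, so
    \<open>C / 6 < a powr \<epsilon>\<close> forces \<open>card A \<ge> 2\<close>.\<close>
  define C where "C = 120 * B + 6"
  define c where "c = 3 + 2 * sqrt (2::real)"
  have "sqrt 2 \<le> 3 / 2" by (rule real_le_lsqrt) (auto simp: power2_eq_square)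
  then have c: "3 \<le> c" "c \<le> 6" by (auto simp: c_def)
  have bound: "c * real (card A) - C * real (card A) powr (1 - \<epsilon>) \<le> real (card (dilate_sum A))" if "finite A" for A
    using that
  proof (induction "card A" arbitrary: A rule: less_induct)
    case less
    define a where "a = real (card A)"
    define e where "e = a powr (1 - \<epsilon>)"
    have e0: "e \<ge> 0" by (simp add: e_def)
    have a0: "a \<ge> 0" by (simp add: a_def)
    have asplit: "a = a powr \<epsilon> * e" by (cases "a = 0") (use a0 in \<open>auto simp: e_def simp flip: powr_add\<close>)
    show ?case
    proof (cases "card (dilate_sum A) > 6 * card A \<or> a powr \<epsilon> \<le> C / 6")
      case True
      \<comment> \<open>Trivial range: either the sumset exceeds \<open>6 * a \<ge> c * a\<close>,
        or \<open>6 * a \<le> C * e\<close> makes the claimed lower bound nonpositive.\<close>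
      then show ?thesis
      proof
        assume "card (dilate_sum A) > 6 * card A"
        then have "6 * a \<le> real (card (dilate_sum A))" by (simp add: a_def)
        moreover have "c * a \<le> 6 * a" using c a0 by (intro mult_right_mono)
        moreover have "0 \<le> C * e" using e0 B by (simp add: C_def)
        ultimately show ?thesis unfolding a_def[symmetric] e_def[symmetric] by linarith
      next
        assume "a powr \<epsilon> \<le> C / 6"
        then have "a powr \<epsilon> * e \<le> C / 6 * e" using e0 by (intro mult_right_mono)
        then have "6 * a \<le> C * e" using asplit by simp
        moreover have "c * a \<le> 6 * a" using c a0 by (intro mult_right_mono)
        ultimately show ?thesis unfolding a_def[symmetric] e_def[symmetric] by linarith
      qed
    next
      case False
      then have small: "card (dilate_sum A) \<le> 6 * card A" and big: "C / 6 < a powr \<epsilon>" by auto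
      have Ca: "C * e \<le> 6 * a"
      proof -
        have "C / 6 * e \<le> a powr \<epsilon> * e" using big e0 by (intro mult_right_mono) auto
        then show ?thesis using asplit by simp
      qed
      have "card A \<ge> 2"
      proof (rule ccontr)
        assume "\<not> card A \<ge> 2"
        then have "a \<le> 1" by (simp add: a_def)
        then have "a powr \<epsilon> \<le> 1" using a0 \<epsilon> by (simp add: powr_le1)
        then show False using big B by (simp add: C_def)
      qed
      then have ne: "A \<noteq> {}" by auto
      obtain A' where A': "finite A'" "card A' = card A" "card (dilate_sum A') = card (dilate_sum A)"
        "real (card (fst ` A')) \<le> B * e" "real (card (snd ` A')) \<le> B * e"
        using lines[OF less.prems ne small] unfolding a_def[symmetric] e_def[symmetric] by blast
      define R where "R = nat \<lfloor>B * e\<rfloor>"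
      have "card (fst ` A') \<le> R" "card (snd ` A') \<le> R" "card A' \<ge> 2"
        using A'(2,4,5) \<open>card A \<ge> 2\<close> by (auto simp: R_def le_nat_floor)
      then obtain A2 where A2: "finite A2" "card A2 = card A'" "card (dilate_sum A2) = card (dilate_sum A')"
        "card (fst ` A2) \<le> R" "card (snd ` A2) \<le> R" "\<exists>x\<in>A2. even (fst x)" "\<exists>x\<in>A2. odd (fst x)"
        using both_parities[OF A'(1)] by blast
      have "real R \<le> B * e" using B e0 by (simp add: R_def)
      then have R2: "real (card (fst ` A2)) \<le> B * e" "real (card (snd ` A2)) \<le> B * e"
        using A2(4,5) by linarith+
      obtain A0 A1 :: "(int \<times> int) set" where A1: "card A0 > 0" "finite A1" "card A2 = card A0 + card A1" "card A0 \<le> card A1"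
        "real (card (dilate_sum A1)) + real (card A0) + real (card A2)
          + 2 * sqrt (real (card A0) * real (card A2)) - 5 * (B * e) \<le> real (card (dilate_sum A2))"
        by (rule dilate_sum_split[OF A2(1,6,7) R2])
      define b where "b = real (card A0)"
      define s where "s = sqrt (b / a)"
      have a1: "real (card A1) = a - b" using A1(3) unfolding A2(2) A'(2) by (simp add: a_def b_def)
      have apos: "a > 0" using ne less.prems by (simp add: a_def card_gt_0_iff)
      have b2: "2 * b \<le> a" using A1(4) a1 by (simp add: b_def)
      have bpos: "b > 0" using A1(1) by (simp add: b_def)
      have "s\<^sup>2 = b / a" using apos bpos by (simp add: s_def)
      then have sb1: "b = s\<^sup>2 * a" using apos by simp
      have sb2: "s \<ge> 0" using apos bpos by (simp add: s_def)
      have "(s * a)\<^sup>2 = b * a" by (subst sb1) (simp add: power2_eq_square)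
      then have sb3: "sqrt (b * a) = s * a" by (rule real_sqrt_unique) (use sb2 apos in simp)
      have "2 * s\<^sup>2 * a \<le> 1 * a" using b2 by (subst (asm) sb1) simp
      then have s2: "2 * s\<^sup>2 \<le> 1" using apos by (simp only: mult_le_cancel_right_pos)
      have IH: "c * (a - b) - C * (a - b) powr (1 - \<epsilon>) \<le> real (card (dilate_sum A1))"
        using less.hyps[of A1] A1 A2(2) A'(2) a1 by simp
      have low: "c * (a - b) - C * (a - b) powr (1 - \<epsilon>) + b + a + 2 * (s * a) - 5 * B * e \<le> real (card (dilate_sum A))"
        using IH A1(5) sb3 A2(2,3) A'(2,3) unfolding b_def[symmetric] by (simp add: a_def[symmetric] mult_ac)
      \<comment> \<open>With \<open>b = s\<^sup>2 * a\<close>, the coefficient of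
        \<open>s\<^sup>2 * a\<close> on the right is
        \<open>1 - c = - (2 + 2 * sqrt 2)\<close>.\<close>
      have sur: "c * a + (1 + 2 * s - (2 + 2 * sqrt 2) * s\<^sup>2) * a = c * (a - b) + b + a + 2 * (s * a)"
        by (subst (1 2) sb1) (simp add: c_def algebra_simps)
      have "5 * B * e \<le> (1 + 2 * s - (2 + 2 * sqrt 2) * s\<^sup>2) * a + C * e - C * (a - b) powr (1 - \<epsilon>)"
      proof (cases "s \<le> 1 / 2")
        case True
        have "(a - b) powr (1 - \<epsilon>) \<le> e" unfolding e_def using b2 bpos \<epsilon> by (intro powr_mono2) auto
        then have "C * (a - b) powr (1 - \<epsilon>) \<le> C * e" using B by (intro mult_left_mono) (auto simp: C_def)
        moreover have "1 / 4 * a \<le> (1 + 2 * s - (2 + 2 * sqrt 2) * s\<^sup>2) * a"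
          using surplus_ge(2)[OF sb2 s2 True] apos by (intro mult_right_mono) auto
        moreover have "120 * B * e \<le> C * e" using e0 by (intro mult_right_mono) (auto simp: C_def)
        ultimately show ?thesis using Ca by linarith
      next
        case False
        have "(1 / 2)\<^sup>2 \<le> s\<^sup>2" using False by (intro power_mono) auto
        then have "1 / 4 * a \<le> s\<^sup>2 * a" using apos by (intro mult_right_mono) (auto simp: power2_eq_square)
        then have "a - b \<le> 3 / 4 * a" using sb1 by simp
        then have "(a - b) powr (1 - \<epsilon>) \<le> (3 / 4 * a) powr (1 - \<epsilon>)" using b2 bpos \<epsilon> by (intro powr_mono2) auto
        also have "\<dots> = (3 / 4) powr (1 - \<epsilon>) * e" unfolding e_def by (rule powr_mult)
        \<comment> \<open>The bound \<open>\<epsilon> \<le> 1 / 2\<close> keeps the factor away from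
          1, so a tenth of \<open>C * e\<close> is left for the rows and columns.\<close>
        also have "\<dots> \<le> 9 / 10 * e"
        proof (intro mult_right_mono e0)
          have "(3 / 4 :: real) powr (1 - \<epsilon>) \<le> (3 / 4) powr (1 / 2)" using \<epsilon> by (intro powr_mono') auto
          also have "\<dots> = sqrt (3 / 4)" by (simp add: powr_half_sqrt)
          also have "\<dots> \<le> 9 / 10" by (rule real_le_lsqrt) (auto simp: power2_eq_square)
          finally show "(3 / 4 :: real) powr (1 - \<epsilon>) \<le> 9 / 10" .
        qed
        finally have "C * (a - b) powr (1 - \<epsilon>) \<le> C * (9 / 10 * e)" using B by (intro mult_left_mono) (auto simp: C_def)
        moreover have "0 \<le> (1 + 2 * s - (2 + 2 * sqrt 2) * s\<^sup>2) * a"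
          using surplus_ge(1)[OF sb2 s2] apos by (intro mult_nonneg_nonneg) auto
        moreover have "120 * B * e \<le> C * e" using e0 by (intro mult_right_mono) (auto simp: C_def)
        moreover have "0 \<le> B * e" using B e0 by simp
        ultimately show ?thesis by linarith
      qed
      then show ?thesis using low sur unfolding a_def[symmetric] e_def[symmetric] by linarith
    qed
  qed
  show ?thesis by (rule that[of C \<epsilon>]) (use B \<epsilon> bound in \<open>auto simp: C_def c_def\<close>)
qed

section \<open>Reduction to the integer lattice\<close>

text \<open>\<open>f\<close> is a coordinate with respect to a Hamel basis of the reals over the
  rationals; a nonzero \<open>x\<close> has a nonzero coordinate.\<close>

lemma exists_additive_nonzero:
  fixes x :: real
  assumes "x \<noteq> 0"
  shows "\<exists>f :: real \<Rightarrow> rat. (\<forall>u v. f (u + v) = f u + f v) \<and> f x \<noteq> 0"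
proof -
  interpret V: vector_space "\<lambda>(q :: rat) (u :: real). of_rat q * u"
    by unfold_locales (simp_all add: of_rat_add of_rat_mult algebra_simps)
  define B where "B = V.extend_basis {}"
  have B: "V.independent B" "V.span B = UNIV"
    unfolding B_def by (simp_all add: V.independent_extend_basis V.span_extend_basis V.independent_empty)
  have "\<exists>b. V.representation B x b \<noteq> 0"
  proof (rule ccontr)
    assume "\<not> ?thesis"
    then have "{b. V.representation B x b \<noteq> 0} = {}" by simp
    then have "x = 0" using V.sum_nonzero_representation_eq[OF B(1), of x] B(2) by simp
    then show False using assms by simp
  qed
  then obtain b where "V.representation B x b \<noteq> 0" by blast
  moreover have "V.representation B (u + v) b = V.representation B u b + V.representation B v b" for u v
    using V.representation_add[OF B(1)] B(2) by simp
  ultimately show ?thesis by (intro exI[of _ "\<lambda>u. V.representation B u b"]) simp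
qed

text \<open>If \<open>f\<close> vanishes at a new nonzero \<open>s\<close>, it is replaced by
  \<open>f + t * g\<close> with \<open>g s \<noteq> 0\<close>. Each nonzero \<open>x\<close> rules
  out at most one rational \<open>t\<close>.\<close>

lemma exists_additive_nonzero_on:
  fixes S :: "real set"
  assumes "finite S"
  shows "\<exists>f :: real \<Rightarrow> rat. (\<forall>u v. f (u + v) = f u + f v) \<and> (\<forall>x\<in>S. x \<noteq> 0 \<longrightarrow> f x \<noteq> 0)"
  using assms
proof (induction S)
  case empty
  show ?case by (intro exI[of _ "\<lambda>_. 0"]) simp
next
  case (insert s S)
  then obtain f :: "real \<Rightarrow> rat" where f: "\<And>u v. f (u + v) = f u + f v" "\<And>x. x \<in> S \<Longrightarrow> x \<noteq> 0 \<Longrightarrow> f x \<noteq> 0"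
    by blast
  show ?case
  proof (cases "s = 0 \<or> f s \<noteq> 0")
    case True
    then show ?thesis using f by (intro exI[of _ f]) auto
  next
    case False
    then obtain g :: "real \<Rightarrow> rat" where g: "\<And>u v. g (u + v) = g u + g v" "g s \<noteq> 0"
      using exists_additive_nonzero by blast
    obtain t :: rat where t: "t \<notin> (\<lambda>x. - f x / g x) ` insert s S"
      using ex_new_if_finite[OF infinite_UNIV_char_0, of "(\<lambda>x. - f x / g x) ` insert s S"] insert.hyps by auto
    have "f x + t * g x \<noteq> 0" if "x \<in> insert s S" "x \<noteq> 0" for x
    proof (cases "g x = 0")
      case True
      then show ?thesis using that f(2) g(2) by auto
    next
      case False
      then have "t \<noteq> - f x / g x" using t that by blast
      show ?thesis
      proof
        assume "f x + t * g x = 0"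
        then have "t * g x = - f x" by (simp add: eq_neg_iff_add_eq_0 add.commute)
        then have "t = - f x / g x" using False by (metis nonzero_mult_div_cancel_right)
        then show False using \<open>t \<noteq> - f x / g x\<close> by contradiction
      qed
    qed
    then show ?thesis
      by (intro exI[of _ "\<lambda>x. f x + t * g x"]) (auto simp: f g algebra_simps)
  qed
qed

lemma common_denominator:
  fixes f :: "'a \<Rightarrow> rat"
  assumes "finite X"
  shows "\<exists>N :: int. N > 0 \<and> (\<forall>x\<in>X. of_int N * f x \<in> \<int>)"
  using assms
proof (induction X)
  case empty
  show ?case by (intro exI[of _ 1]) simp
next
  case (insert y X)
  then obtain N :: int where N: "N > 0" "\<And>x. x \<in> X \<Longrightarrow> of_int N * f x \<in> \<int>" by blast
  obtain p q :: int where pq: "f y = of_int p / of_int q" "q > 0"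
    by (metis quotient_of_div quotient_of_denom_pos surj_pair)
  have "of_int (N * q) * f x \<in> \<int>" if "x \<in> insert y X" for x
  proof (cases "x = y")
    case True
    then have "of_int (N * q) * f x = of_int (N * p)" using pq by simp
    then show ?thesis by (metis Ints_of_int)
  next
    case False
    then have "of_int N * f x \<in> \<int>" using that N by simp
    then have "of_int q * (of_int N * f x) \<in> \<int>" by (rule Ints_mult[OF Ints_of_int])
    moreover have "of_int (N * q) * f x = of_int q * (of_int N * f x)" by simp
    ultimately show ?thesis by metis
  qed
  then show ?case using N pq by (intro exI[of _ "N * q"]) simp
qed

text \<open>\<open>G\<close> carries multiplication by \<open>sqrt 2\<close> on \<open>A\<close> to
  \<open>sqrt2_mult\<close>, because \<open>F (sqrt 2 * (sqrt 2 * x)) = 2 * F x\<close>. It is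
  injective on \<open>A\<close> but may collapse points of the sumset, hence the inequality.\<close>

lemma reduction_to_lattice:
  fixes A :: "real set"
  assumes "finite A"
  shows "\<exists>A' :: (int \<times> int) set. finite A' \<and> card A' = card A \<and>
    card (dilate_sum A') \<le> card (sum_dilate (sqrt 2) A)"
proof -
  have "finite ((\<lambda>(x, y). x - y) ` (A \<times> A))" using assms by simp
  from exists_additive_nonzero_on[OF this] obtain f :: "real \<Rightarrow> rat"
    where "\<forall>u v. f (u + v) = f u + f v"
      and nz0: "\<forall>x\<in>(\<lambda>(x, y). x - y) ` (A \<times> A). x \<noteq> 0 \<longrightarrow> f x \<noteq> 0"
    by blast
  then have f: "f (u + v) = f u + f v" for u v by blast
  have nz: "f (x - y) \<noteq> 0" if "x \<in> A" "y \<in> A" "x \<noteq> y" for x y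
    using bspec[OF nz0, of "x - y"] that by force
  interpret f: additive f by standard (rule f)
  have "finite (A \<union> (*) (sqrt 2) ` A)" using assms by simp
  from common_denominator[OF this, of f] obtain N :: int
    where N: "N > 0" "\<forall>x\<in>A \<union> (*) (sqrt 2) ` A. of_int N * f x \<in> \<int>"
    by blast
  \<comment> \<open>Scaling by the common denominator makes the floor exact on \<open>A\<close> and
    on its dilate, and by additivity of \<open>f\<close> at the sums evaluated below.\<close>
  define F where "F x = \<lfloor>of_int N * f x\<rfloor>" for x
  have F: "of_int (F x) = of_int N * f x" if x: "x \<in> A \<union> (*) (sqrt 2) ` A" for x
  proof -
    obtain k where "of_int N * f x = of_int k" by (rule Ints_cases[OF bspec[OF N(2) x]])
    then show ?thesis unfolding F_def by simp
  qed
  have F_eq: "F x = k" if "of_int N * f x = of_int k" for x k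
    unfolding F_def that by simp
  define G where "G x = (F (sqrt 2 * x), F x)" for x
  have sq: "sqrt 2 * (sqrt 2 * b) = b + b" for b
    by (subst mult.assoc[symmetric]) simp
  have "inj_on G A"
  proof (rule inj_onI)
    fix x y assume xy: "x \<in> A" "y \<in> A" "G x = G y"
    then have "(of_int (F x) :: rat) = of_int (F y)" by (simp add: G_def)
    then have "f x = f y" using xy N(1) F[of x] F[of y] by simp
    then have "f (x - y) = 0" by (simp add: f.diff)
    then show "x = y" using nz xy by blast
  qed
  moreover have "dilate_sum (G ` A) \<subseteq> G ` sum_dilate (sqrt 2) A"
  proof
    fix z assume "z \<in> dilate_sum (G ` A)"
    then obtain a b where ab: "a \<in> A" "b \<in> A" and z: "z = G a + sqrt2_mult (G b)"
      by (auto elim!: set_plus_elim)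
    have "F (sqrt 2 * (a + sqrt 2 * b)) = F (sqrt 2 * a) + 2 * F b"
    proof (rule F_eq)
      have "sqrt 2 * (a + sqrt 2 * b) = sqrt 2 * a + (b + b)" by (simp only: distrib_left sq)
      then have "f (sqrt 2 * (a + sqrt 2 * b)) = f (sqrt 2 * a) + (f b + f b)" by (simp only: f)
      moreover have "of_int (F (sqrt 2 * a)) = of_int N * f (sqrt 2 * a)" "of_int (F b) = of_int N * f b"
        using ab by (intro F; simp)+
      ultimately show "of_int N * f (sqrt 2 * (a + sqrt 2 * b)) = of_int (F (sqrt 2 * a) + 2 * F b)"
        by (simp add: distrib_left)
    qed
    moreover have "F (a + sqrt 2 * b) = F a + F (sqrt 2 * b)"
    proof (rule F_eq)
      have "of_int (F a) = of_int N * f a" "of_int (F (sqrt 2 * b)) = of_int N * f (sqrt 2 * b)"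
        using ab by (intro F; simp)+
      then show "of_int N * f (a + sqrt 2 * b) = of_int (F a + F (sqrt 2 * b))"
        by (simp add: distrib_left f)
    qed
    ultimately have "z = G (a + sqrt 2 * b)" by (simp add: z G_def sqrt2_mult_def)
    moreover have "a + sqrt 2 * b \<in> sum_dilate (sqrt 2) A" using ab by (auto simp: sum_dilate_def)
    ultimately show "z \<in> G ` sum_dilate (sqrt 2) A" by blast
  qed
  moreover have "finite (sum_dilate (sqrt 2) A)"
  proof -
    have "sum_dilate (sqrt 2) A = (\<lambda>(a, b). a + sqrt 2 * b) ` (A \<times> A)" by (auto simp: sum_dilate_def)
    then show ?thesis using assms by simp
  qed
  ultimately show ?thesis using assms
    by (intro exI[of _ "G ` A"]) (auto simp: card_image intro: surj_card_le)
qed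

theorem theorem1:
  "\<exists>C \<epsilon> :: real. C > 0 \<and> \<epsilon> > 0 \<and>
     (\<forall>A :: real set. finite A \<longrightarrow>
        real (card (sum_dilate (sqrt 2) A))
          \<ge> (1 + sqrt 2)\<^sup>2 * real (card A) - C * real (card A) powr (1 - \<epsilon>))"
proof -
  obtain C \<epsilon> :: real where C: "C > 0" "\<epsilon> > 0" and bound:
    "\<And>A. finite A \<Longrightarrow> (3 + 2 * sqrt 2) * real (card A) - C * real (card A) powr (1 - \<epsilon>)
      \<le> real (card (dilate_sum A))"
    using dilate_sum_lower_bound by metis
  have c: "(1 + sqrt 2)\<^sup>2 = 3 + 2 * sqrt 2" by (simp add: power2_sum)
  have "(1 + sqrt 2)\<^sup>2 * real (card A) - C * real (card A) powr (1 - \<epsilon>)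
      \<le> real (card (sum_dilate (sqrt 2) A))" if A: "finite A" for A
  proof -
    obtain A' :: "(int \<times> int) set" where "finite A'" "card A' = card A"
      "card (dilate_sum A') \<le> card (sum_dilate (sqrt 2) A)"
      using reduction_to_lattice[OF A] by blast
    then show ?thesis using bound[of A'] unfolding c by simp
  qed
  then show ?thesis using C by blast
qed

end
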